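(* Let $0<k<n$ be integers and let $p:\mathbb{R}^n\to\mathbb{R}^{n-1}$, $p(x_1,\dots,x_n)=(x_1,\dots,x_{n-1})$; $p$ restricts to an affine bijection from $\Delta_{k,n}$ onto $\tilde\Delta_{k,n}$. Then the following four collections of $(n-1)$-dimensional simplices in $\tilde\Delta_{k,n}$ coincide: (1) (Stanley) the closures of the sets $\psi^{-1}(\nabla_w)$, where $w$ ranges over permutations in $S_{n-1}$ whose inverse $w^{-1}$ has exactly $k-1$ descents; (2) (Sturmfels) the simplices $p(\nabla_{\mathcal I})$, where $\mathcal I=(I_1,\dots,I_n)$ ranges over maximal sorted collections of $k$-subsets of $[n]$; (3) (alcove) the alcoves contained in $\tilde\Delta_{k,n}$; (4) (circuit) the simplices $p(\Delta_c)$, where $c$ ranges over minimal circuits of the graph $G_{k,n}$.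
   Context: For $I\subseteq[n]=\{1,\dots,n\}$ with $|I|=k$, $\epsilon_I\in\mathbb{R}^n$ is the 0/1 vector with $\epsilon_i=1$ iff $i\in I$. The hypersimplex is $\Delta_{k,n}=\mathrm{conv}\{\epsilon_I: I\in\binom{[n]}{k}\}=\{x\in[0,1]^n: x_1+\dots+x_n=k\}$, and $\tilde\Delta_{k,n}=\{(x_1,\dots,x_{n-1})\in[0,1]^{n-1}: k-1\le x_1+\dots+x_{n-1}\le k\}$. Stanley's map: $\psi:[0,1]^{n-1}\to[0,1]^{n-1}$, $\psi(x)=(y_1,\dots,y_{n-1})$ with $y_i=(x_1+\dots+x_i)-\lfloor x_1+\dots+x_i\rfloor$. For $w\in S_{n-1}$, $\nabla_w=\{y\in[0,1]^{n-1}: 0<y_{w(1)}<y_{w(2)}<\dots<y_{w(n-1)}<1\}$. A descent of a permutation $u$ is an index $i$ with $u(i)>u(i+1)$. Sorting: for $k$-subsets $I,J$ of $[n]$ let $(a_1,\dots,a_{2k})$ be the nondecreasing ordering of the multiset union $I\cup J$, $U(I,J)=\{a_1,a_3,\dots,a_{2k-1}\}$, $V(I,J)=\{a_2,a_4,\dots,a_{2k}\}$. An ordered pair $(I,J)$ is sorted if $I=U(I,J)$ and $J=V(I,J)$; an ordered collection $(I_1,\dots,I_r)$ is sorted if $(I_i,I_j)$ is sorted for all $i<j$. $\nabla_{\mathcal I}=\mathrm{conv}\{\epsilon_{I_1},\dots,\epsilon_{I_r}\}$. Maximal (by inclusion) sorted collections have exactly $n$ elements. Alcoves: in coordinates $z_i=x_1+\dots+x_i$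 ($1\le i\le n-1$), $z_0=0$, on $\mathbb{R}^{n-1}$, consider the hyperplanes $H^l_{ij}=\{z_i-z_j=l\}$ for $0\le i<j\le n-1$, $l\in\mathbb{Z}$; alcoves are the closures of the connected components of the complement of their union (they are unit simplices). The graph $G_{k,n}$: vertices are the $\epsilon_I$, $I\in\binom{[n]}{k}$; indices are read modulo $n$ ($\epsilon_{n+1}=\epsilon_1$); there is a directed edge $\epsilon\xrightarrow{i}\epsilon'$ labelled $i\in[n]$ whenever $(\epsilon_i,\epsilon_{i+1})=(1,0)$ and $\epsilon'$ is obtained from $\epsilon$ by swapping $\epsilon_i$ and $\epsilon_{i+1}$ (a ``1'' moves cyclically one step right). A minimal circuit is a directed circuit of minimal possible length in $G_{k,n}$: starting from a vertex $\epsilon$, the first ``1'' moves step by step to the position of the second ``1'', the second to the position of the third, ..., and the last ``1'' moves cyclically to the original position of the first; it has length $n$ and its edge labels form a permutation of $[n]$. $\Delta_c$ is the convex hull of the $n$ vertices of the minimal circuit $c$. *)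

theory Defs
  imports
    "HOL-Analysis.Analysis"
    "HOL-Library.Function_Algebras"
    "HOL-Library.Multiset"
    "HOL-Combinatorics.Permutations"
    "Graph_Theory.Arc_Walk"
begin

text \<open>
  Both \<open>n\<close>-dimensional and \<open>(n - 1)\<close>-dimensional space occur for a variable \<open>n\<close>, so points are
  functions \<open>nat \<Rightarrow> real\<close> vanishing outside \<open>{1..m}\<close> (the coordinates are numbered from 1). The
  pointwise vector space structure makes the library notions \<open>convex hull\<close>,
  \<open>affine_dependent\<close> and \<open>linear\<close> available. The topology on functions is the product topology;
  \<open>coord_space m\<close> is closed in it and inherits the usual topology of Euclidean \<open>m\<close>-space, so that
  \<open>closure\<close> and \<open>components\<close> of its subsets are the usual ones.
\<close>

instantiation "fun" :: (type, scaleR) scaleR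
begin

definition scaleR_fun_def: "scaleR r f = (\<lambda>x. scaleR r (f x))"

instance ..

end

instance "fun" :: (type, real_vector) real_vector
  by standard (simp_all add: scaleR_fun_def fun_eq_iff scaleR_add_right scaleR_add_left)

definition coord_space :: "nat \<Rightarrow> (nat \<Rightarrow> real) set" where
  "coord_space m = {x. \<forall>i. i \<notin> {1..m} \<longrightarrow> x i = 0}"

definition unit_cube :: "nat \<Rightarrow> (nat \<Rightarrow> real) set" where
  "unit_cube m = {x \<in> coord_space m. \<forall>i\<in>{1..m}. 0 \<le> x i \<and> x i \<le> 1}"

definition drop_last_coord :: "nat \<Rightarrow> (nat \<Rightarrow> real) \<Rightarrow> (nat \<Rightarrow> real)" where
  "drop_last_coord n x = (\<lambda>i. if i \<in> {1..n - 1} then x i else 0)"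

text \<open>
  The definition of \<open>simplex\<close> in the theory \<open>Polytope\<close>, which is restricted there to the class
  \<open>euclidean_space\<close>.
\<close>

definition is_simplex :: "nat \<Rightarrow> (nat \<Rightarrow> real) set \<Rightarrow> bool" where
  "is_simplex d S \<longleftrightarrow>
     (\<exists>C. finite C \<and> \<not> affine_dependent C \<and> card C = d + 1 \<and> S = convex hull C)"


subsection \<open>Hypersimplices\<close>

definition k_subsets :: "nat \<Rightarrow> nat \<Rightarrow> nat set set" where
  "k_subsets k n = {I. I \<subseteq> {1..n} \<and> card I = k}"

definition eps :: "nat set \<Rightarrow> nat \<Rightarrow> real" where
  "eps I = indicator I"

definition hypersimplex :: "nat \<Rightarrow> nat \<Rightarrow> (nat \<Rightarrow> real) set" where
  "hypersimplex k n = convex hull (eps ` k_subsets k n)"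

definition proj_hypersimplex :: "nat \<Rightarrow> nat \<Rightarrow> (nat \<Rightarrow> real) set" where
  "proj_hypersimplex k n =
     {x \<in> unit_cube (n - 1). real k - 1 \<le> (\<Sum>i=1..n - 1. x i) \<and> (\<Sum>i=1..n - 1. x i) \<le> real k}"


subsection \<open>Stanley's triangulation\<close>

definition stanley_map :: "nat \<Rightarrow> (nat \<Rightarrow> real) \<Rightarrow> (nat \<Rightarrow> real)" where
  "stanley_map m x = (\<lambda>i. if i \<in> {1..m} then frac (\<Sum>j=1..i. x j) else 0)"

definition perm_region :: "nat \<Rightarrow> (nat \<Rightarrow> nat) \<Rightarrow> (nat \<Rightarrow> real) set" where
  "perm_region m w =
     {y \<in> unit_cube m. 0 < y (w 1) \<and> (\<forall>i\<in>{1..<m}. y (w i) < y (w (i + 1))) \<and> y (w m) < 1}"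

definition descents :: "nat \<Rightarrow> (nat \<Rightarrow> nat) \<Rightarrow> nat set" where
  "descents m u = {i \<in> {1..<m}. u i > u (i + 1)}"

definition stanley_simplices :: "nat \<Rightarrow> nat \<Rightarrow> (nat \<Rightarrow> real) set set" where
  "stanley_simplices k n =
     {closure {x \<in> unit_cube (n - 1). stanley_map (n - 1) x \<in> perm_region (n - 1) w} | w.
        w permutes {1..n - 1} \<and> card (descents (n - 1) (inv w)) = k - 1}"


subsection \<open>Sturmfels' triangulation\<close>

definition sorted_union :: "nat set \<Rightarrow> nat set \<Rightarrow> nat list" where
  "sorted_union I J = sorted_list_of_multiset (mset_set I + mset_set J)"

text \<open>
  List positions are numbered from 0, so \<open>a\<^sub>1, a\<^sub>3, \<dots>\<close> are the entries at even positions.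
\<close>

definition sort_U :: "nat set \<Rightarrow> nat set \<Rightarrow> nat set" where
  "sort_U I J = {sorted_union I J ! i | i. i < length (sorted_union I J) \<and> even i}"

definition sort_V :: "nat set \<Rightarrow> nat set \<Rightarrow> nat set" where
  "sort_V I J = {sorted_union I J ! i | i. i < length (sorted_union I J) \<and> odd i}"

definition sorted_pair :: "nat set \<Rightarrow> nat set \<Rightarrow> bool" where
  "sorted_pair I J \<longleftrightarrow> I = sort_U I J \<and> J = sort_V I J"

text \<open>
  Since every pair \<open>(I, I)\<close> is sorted, the members of a collection have to be required distinct.
\<close>

definition sorted_collection :: "nat \<Rightarrow> nat \<Rightarrow> nat set list \<Rightarrow> bool" where
  "sorted_collection k n Is \<longleftrightarrow>
     set Is \<subseteq> k_subsets k n \<and> distinct Is \<and>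
     (\<forall>i j. i < j \<and> j < length Is \<longrightarrow> sorted_pair (Is ! i) (Is ! j))"

definition maximal_sorted_collection :: "nat \<Rightarrow> nat \<Rightarrow> nat set list \<Rightarrow> bool" where
  "maximal_sorted_collection k n Is \<longleftrightarrow>
     sorted_collection k n Is \<and> \<not> (\<exists>Js. sorted_collection k n Js \<and> set Is \<subset> set Js)"

definition sturmfels_simplices :: "nat \<Rightarrow> nat \<Rightarrow> (nat \<Rightarrow> real) set set" where
  "sturmfels_simplices k n =
     {drop_last_coord n ` (convex hull (eps ` set Is)) | Is. maximal_sorted_collection k n Is}"


subsection \<open>Alcoves\<close>

definition z_coord :: "(nat \<Rightarrow> real) \<Rightarrow> nat \<Rightarrow> real" where
  "z_coord x i = (\<Sum>j=1..i. x j)"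

definition alcove_hyperplane :: "nat \<Rightarrow> nat \<Rightarrow> nat \<Rightarrow> int \<Rightarrow> (nat \<Rightarrow> real) set" where
  "alcove_hyperplane m i j l = {x \<in> coord_space m. z_coord x i - z_coord x j = of_int l}"

definition alcoves :: "nat \<Rightarrow> (nat \<Rightarrow> real) set set" where
  "alcoves m =
     closure ` components
       (coord_space m - \<Union>{alcove_hyperplane m i j l | i j l. i < j \<and> j \<le> m})"

definition alcove_simplices :: "nat \<Rightarrow> nat \<Rightarrow> (nat \<Rightarrow> real) set set" where
  "alcove_simplices k n = {A \<in> alcoves (n - 1). A \<subseteq> proj_hypersimplex k n}"


subsection \<open>The circuit triangulation\<close>

definition cyc_succ :: "nat \<Rightarrow> nat \<Rightarrow> nat" where
  "cyc_succ n i = (if i = n then 1 else i + 1)"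

text \<open>An arc \<open>(e, i, e')\<close> is an edge from \<open>e\<close> to \<open>e'\<close> with label \<open>i\<close>.\<close>

type_synonym labelled_arc = "(nat \<Rightarrow> real) \<times> nat \<times> (nat \<Rightarrow> real)"

definition circuit_graph :: "nat \<Rightarrow> nat \<Rightarrow> (nat \<Rightarrow> real, labelled_arc) pre_digraph" where
  "circuit_graph k n =
     \<lparr> verts = eps ` k_subsets k n,
       arcs = {(e, i, e').
         e \<in> eps ` k_subsets k n \<and> i \<in> {1..n} \<and> e i = 1 \<and> e (cyc_succ n i) = 0 \<and>
         e' = e(i := e (cyc_succ n i), cyc_succ n i := e i)},
       tail = (\<lambda>(e, i, e'). e),
       head = (\<lambda>(e, i, e'). e') \<rparr>"

definition minimal_circuit :: "nat \<Rightarrow> nat \<Rightarrow> labelled_arc list \<Rightarrow> bool" where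
  "minimal_circuit k n c \<longleftrightarrow> is_arg_min length (pre_digraph.cycle (circuit_graph k n)) c"

definition circuit_simplices :: "nat \<Rightarrow> nat \<Rightarrow> (nat \<Rightarrow> real) set set" where
  "circuit_simplices k n =
     {drop_last_coord n ` (convex hull (tail (circuit_graph k n) ` set c)) | c.
        minimal_circuit k n c}"

end

theory Submission
  imports Defs
begin

text \<open>
  Write \<open>n = m + 1\<close>. In the partial sums \<open>z\<^sub>i = x\<^sub>1 + \<dots> + x\<^sub>i\<close>, all four collections consist of the
  closed cells of the permutations \<open>u = w\<^sup>-\<^sup>1\<close> with \<open>k - 1\<close> descents, where the cell of \<open>u\<close> is cut out by
  prescribing \<open>\<lfloor>z\<^sub>i\<rfloor>\<close> as the number of descents of \<open>u\<close> before \<open>i\<close> and the order of the fractional parts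
  of the \<open>z\<^sub>i\<close> by \<open>u\<close>. On the unit cube the order already determines the integer parts, which gives
  Stanley's regions; a connected set avoiding the hyperplanes cannot change any \<open>\<lfloor>z\<^sub>i - z\<^sub>j\<rfloor>\<close>, which
  gives the alcoves.

  A pair of \<open>k\<close>-subsets is sorted iff their counting functions \<open>i \<mapsto> |I \<inter> [i]|\<close> differ by 0 or 1
  everywhere, in the right direction. Hence for a sorted collection the differences \<open>z\<^sub>i - z\<^sub>j\<close> of its
  members take at most two consecutive integer values, so a cell containing the average of the
  members contains all of them as vertices. Such a cell exists because the cells cover the
  hypersimplex: any point is a limit of generic ones. Finally, an arc with label \<open>i < n\<close> lowers the
  counting function at \<open>i\<close> by 1, and one with label \<open>n\<close> raises it by 1 on \<open>[m]\<close>; so a shortest circuit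
  uses every label once, and read from the arc labelled \<open>n\<close> its vertices form a sorted collection of
  maximal size.
\<close>

subsection \<open>Counting functions and sorted collections\<close>

text \<open>These are the partial sums of \<open>eps I\<close> (see \<open>z_coord_eps\<close>),
  kept as natural numbers so that parity and \<open>div\<close> can be applied to them.\<close>

definition card_upto :: "nat set \<Rightarrow> nat \<Rightarrow> nat" where
  "card_upto I i = card {j \<in> I. j \<le> i}"

lemma finite_k_subset: "I \<in> k_subsets k n \<Longrightarrow> finite I"
  by (auto simp: k_subsets_def intro: finite_subset)

lemma card_upto_0: "I \<in> k_subsets k n \<Longrightarrow> card_upto I 0 = 0"
  by (auto simp: card_upto_def k_subsets_def)

lemma card_upto_Suc:
  assumes "finite I"
  shows "card_upto I (Suc i) = card_upto I i + (if Suc i \<in> I then 1 else 0)"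
proof -
  have "{j \<in> I. j \<le> Suc i} = (if Suc i \<in> I then insert (Suc i) {j \<in> I. j \<le> i} else {j \<in> I. j \<le> i})"
    by (auto simp: le_Suc_eq)
  then show ?thesis
    using assms by (simp add: card_upto_def)
qed

lemma card_upto_top: "I \<in> k_subsets k n \<Longrightarrow> n \<le> i \<Longrightarrow> card_upto I i = k"
proof -
  assume "I \<in> k_subsets k n" "n \<le> i"
  then have "{j \<in> I. j \<le> i} = I" "card I = k"
    by (auto simp: k_subsets_def)
  then show ?thesis by (simp add: card_upto_def)
qed

text \<open>Membership of \<open>Suc i\<close> is the jump of the counting function at
  \<open>Suc i\<close>. All \<open>k\<close>-subsets share the value 0 at 0 and \<open>k\<close>
  from \<open>n\<close> on, so only the indices in between carry information.\<close>

lemma k_subset_eqI: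
  assumes I: "I \<in> k_subsets k n" and J: "J \<in> k_subsets k n"
    and eq: "\<And>i. 1 \<le> i \<Longrightarrow> i < n \<Longrightarrow> card_upto I i = card_upto J i"
  shows "I = J"
proof -
  have eq': "card_upto I i = card_upto J i" for i
    using eq[of i] card_upto_top[OF I, of i] card_upto_top[OF J, of i]
      card_upto_0[OF I] card_upto_0[OF J]
    by (cases "i = 0"; cases "n \<le> i") auto
  have "Suc i \<in> I \<longleftrightarrow> Suc i \<in> J" for i
    using card_upto_Suc[OF finite_k_subset[OF I], of i] card_upto_Suc[OF finite_k_subset[OF J], of i]
      eq'[of i] eq'[of "Suc i"] by (auto split: if_splits)
  moreover have "0 \<notin> I" "0 \<notin> J"
    using I J by (auto simp: k_subsets_def)
  ultimately show ?thesis
    by (metis not0_implies_Suc set_eqI)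
qed

text \<open>In a sorted list the entries that are at most \<open>a\<close> form an initial segment,
  whose length the filter measures.\<close>

lemma sorted_nth_le_iff:
  assumes "sorted xs" "t < length xs"
  shows "xs ! t \<le> (a :: 'a :: linorder) \<longleftrightarrow> t < length (filter (\<lambda>x. x \<le> a) xs)"
  using assms
proof (induction xs arbitrary: t)
  case (Cons x xs)
  show ?case
  proof (cases "x \<le> a")
    case True
    then show ?thesis using Cons by (cases t) auto
  next
    case False
    then have "filter (\<lambda>y. y \<le> a) (x # xs) = []"
      using Cons.prems by (auto simp: filter_empty_conv)
    moreover have "x \<le> (x # xs) ! t"
      using Cons.prems by (cases t) auto
    ultimately show ?thesis using False by auto
  qed
qed simp

lemma sorted_union_nth_le_iff:
  assumes "finite I" "finite J" "t < length (sorted_union I J)"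
  shows "sorted_union I J ! t \<le> i \<longleftrightarrow> t < card_upto I i + card_upto J i"
proof -
  have "mset (filter (\<lambda>x. x \<le> i) (sorted_union I J)) =
      mset_set {x \<in> I. x \<le> i} + mset_set {x \<in> J. x \<le> i}"
    using assms by (simp add: sorted_union_def mset_filter)
  then have "length (filter (\<lambda>x. x \<le> i) (sorted_union I J)) = card_upto I i + card_upto J i"
    by (metis size_mset size_union size_mset_set card_upto_def)
  moreover have "sorted (sorted_union I J)"
    by (simp add: sorted_union_def)
  ultimately show ?thesis
    using sorted_nth_le_iff[OF _ assms(3)] by simp
qed

lemma length_sorted_union:
  assumes "finite I" "finite J"
  shows "length (sorted_union I J) = card I + card J"
proof -
  have "mset (sorted_union I J) = mset_set I + mset_set J"
    by (simp add: sorted_union_def)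
  then show ?thesis
    by (metis size_mset size_union size_mset_set)
qed

lemma sorted_union_nth_eq_iff:
  assumes "finite I" "finite J" "t < length (sorted_union I J)"
  shows "sorted_union I J ! t = Suc i \<longleftrightarrow>
    card_upto I i + card_upto J i \<le> t \<and> t < card_upto I (Suc i) + card_upto J (Suc i)"
  using sorted_union_nth_le_iff[OF assms, of i] sorted_union_nth_le_iff[OF assms, of "Suc i"]
  by auto

lemma card_upto_le_card: "finite I \<Longrightarrow> card_upto I i \<le> card I"
  by (auto simp: card_upto_def intro: card_mono)

text \<open>The copies of \<open>Suc i\<close> in the sorted union occupy the positions from
  \<open>?a\<close> up to, but excluding, \<open>?b\<close>. There are \<open>(t + 1) div 2\<close>
  even positions below \<open>t\<close>, so the inequality says that this block contains an even
  position.\<close>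

lemma Suc_mem_sort_U_iff:
  assumes "finite I" "finite J"
  shows "Suc i \<in> sort_U I J \<longleftrightarrow>
    (card_upto I i + card_upto J i + 1) div 2 < (card_upto I (Suc i) + card_upto J (Suc i) + 1) div 2"
    (is "_ \<longleftrightarrow> (?a + 1) div 2 < (?b + 1) div 2")
proof -
  have b: "?b \<le> length (sorted_union I J)"
    using card_upto_le_card[OF assms(1), of "Suc i"] card_upto_le_card[OF assms(2), of "Suc i"]
    by (simp add: length_sorted_union[OF assms])
  have "Suc i \<in> sort_U I J \<longleftrightarrow>
      (\<exists>t. t < length (sorted_union I J) \<and> even t \<and> sorted_union I J ! t = Suc i)"
    by (auto simp: sort_U_def; metis)
  also have "\<dots> \<longleftrightarrow> (\<exists>t. ?a \<le> t \<and> t < ?b \<and> even t)"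
    using b sorted_union_nth_eq_iff[OF assms] by (meson less_le_trans)
  also have "\<dots> \<longleftrightarrow> (?a + 1) div 2 < (?b + 1) div 2"
  proof
    assume "(?a + 1) div 2 < (?b + 1) div 2"
    \<comment> \<open>The witness is the least even number that is at least
      \<open>?a\<close>.\<close>
    then have "?a \<le> 2 * ((?a + 1) div 2)" "2 * ((?a + 1) div 2) < ?b" by presburger+
    then show "\<exists>t. ?a \<le> t \<and> t < ?b \<and> even t" by (metis dvd_triv_left)
  qed presburger
  finally show ?thesis .
qed

text \<open>The block of positions is the same as for \<open>sort_U\<close>; now
  \<open>t div 2\<close> counts the odd positions below \<open>t\<close>.\<close>

lemma Suc_mem_sort_V_iff:
  assumes "finite I" "finite J"
  shows "Suc i \<in> sort_V I J \<longleftrightarrow>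
    (card_upto I i + card_upto J i) div 2 < (card_upto I (Suc i) + card_upto J (Suc i)) div 2"
    (is "_ \<longleftrightarrow> ?a div 2 < ?b div 2")
proof -
  have b: "?b \<le> length (sorted_union I J)"
    using card_upto_le_card[OF assms(1), of "Suc i"] card_upto_le_card[OF assms(2), of "Suc i"]
    by (simp add: length_sorted_union[OF assms])
  have "Suc i \<in> sort_V I J \<longleftrightarrow>
      (\<exists>t. t < length (sorted_union I J) \<and> odd t \<and> sorted_union I J ! t = Suc i)"
    by (auto simp: sort_V_def; metis)
  also have "\<dots> \<longleftrightarrow> (\<exists>t. ?a \<le> t \<and> t < ?b \<and> odd t)"
    using b sorted_union_nth_eq_iff[OF assms] by (meson less_le_trans)
  also have "\<dots> \<longleftrightarrow> ?a div 2 < ?b div 2"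
  proof
    assume "?a div 2 < ?b div 2"
    then have "?a \<le> 2 * (?a div 2) + 1" "2 * (?a div 2) + 1 < ?b" by presburger+
    then show "\<exists>t. ?a \<le> t \<and> t < ?b \<and> odd t" by (metis odd_two_times_div_two_succ even_plus_one_iff dvd_triv_left)
  qed presburger
  finally show ?thesis .
qed

lemma zero_notin_sorted_union:
  assumes "0 \<notin> I" "0 \<notin> J" "finite I" "finite J"
  shows "0 \<notin> sort_U I J" "0 \<notin> sort_V I J"
proof -
  have "set (sorted_union I J) = set_mset (mset_set I + mset_set J)"
    by (metis mset_sorted_list_of_multiset set_mset_mset sorted_union_def)
  then have "set (sorted_union I J) = I \<union> J"
    using assms by simp
  then have "\<And>t. t < length (sorted_union I J) \<Longrightarrow> sorted_union I J ! t \<noteq> 0"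
    using assms by (metis UnE nth_mem)
  then show "0 \<notin> sort_U I J" "0 \<notin> sort_V I J"
    by (fastforce simp: sort_U_def sort_V_def)+
qed

text \<open>One step of the induction in \<open>sorted_pair_iff\<close>: \<open>a\<close> and
  \<open>b\<close> are the counting functions of the two sets at \<open>i\<close>, and
  \<open>p\<close> and \<open>q\<close> their jumps at \<open>Suc i\<close>. Only eight cases
  remain.\<close>

lemma interlace_step:
  fixes a b p q :: nat
  assumes "b \<le> a" "a \<le> b + 1" "p \<le> 1" "q \<le> 1"
  shows "(p = 1 \<longleftrightarrow> (a + b + 1) div 2 < (a + p + (b + q) + 1) div 2) \<and>
      (q = 1 \<longleftrightarrow> (a + b) div 2 < (a + p + (b + q)) div 2)
    \<longleftrightarrow> b + q \<le> a + p \<and> a + p \<le> b + q + 1"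
proof -
  have "a = b \<or> a = Suc b" "p = 0 \<or> p = 1" "q = 0 \<or> q = 1"
    using assms by auto
  then show ?thesis by (elim disjE) auto
qed

text \<open>The sorted union is dealt out alternately, beginning with the first set, so at every
  point the first set is level with the second or one ahead. By \<open>step\<close>, interlacing at
  \<open>i\<close> makes the two membership conditions at \<open>Suc i\<close> equivalent to
  interlacing at \<open>Suc i\<close>; this serves both directions.\<close>

lemma sorted_pair_iff:
  assumes I: "I \<in> k_subsets k n" and J: "J \<in> k_subsets k n"
  shows "sorted_pair I J \<longleftrightarrow>
    (\<forall>i. card_upto J i \<le> card_upto I i \<and> card_upto I i \<le> card_upto J i + 1)"
    (is "_ \<longleftrightarrow> (\<forall>i. ?P i)")
proof -
  note fin = finite_k_subset[OF I] finite_k_subset[OF J]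
  have nz: "0 \<notin> I" "0 \<notin> J"
    using I J by (auto simp: k_subsets_def)
  note mU = Suc_mem_sort_U_iff[OF fin] and mV = Suc_mem_sort_V_iff[OF fin]
  note sI = card_upto_Suc[OF fin(1)] and sJ = card_upto_Suc[OF fin(2)]
  have step: "(Suc i \<in> I \<longleftrightarrow> Suc i \<in> sort_U I J) \<and> (Suc i \<in> J \<longleftrightarrow> Suc i \<in> sort_V I J) \<longleftrightarrow> ?P (Suc i)"
    if "?P i" for i
  proof -
    define p q :: nat where "p = (if Suc i \<in> I then 1 else 0)" and "q = (if Suc i \<in> J then 1 else 0)"
    have mem: "Suc i \<in> I \<longleftrightarrow> p = 1" "Suc i \<in> J \<longleftrightarrow> q = 1" and le: "p \<le> 1" "q \<le> 1"
      by (auto simp: p_def q_def)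
    have S: "card_upto I (Suc i) = card_upto I i + p" "card_upto J (Suc i) = card_upto J i + q"
      by (simp_all add: sI sJ p_def q_def)
    show ?thesis
      unfolding mU mV S mem using interlace_step[OF _ _ le] that by blast
  qed
  have base: "?P 0"
    by (simp add: card_upto_0[OF I] card_upto_0[OF J])
  show ?thesis
  proof
    assume "sorted_pair I J"
    then have mem: "(Suc i \<in> I \<longleftrightarrow> Suc i \<in> sort_U I J) \<and> (Suc i \<in> J \<longleftrightarrow> Suc i \<in> sort_V I J)" for i
      by (auto simp: sorted_pair_def)
    show "\<forall>i. ?P i"
    proof
      fix i show "?P i"
      proof (induction i)
        case 0
        show ?case by (rule base)
      next
        case (Suc i)
        show ?case using step[OF Suc] mem[of i] by blast
      qed
    qed
  next
    assume A: "\<forall>i. ?P i"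
    have "(Suc i \<in> I \<longleftrightarrow> Suc i \<in> sort_U I J) \<and> (Suc i \<in> J \<longleftrightarrow> Suc i \<in> sort_V I J)" for i
      using step[of i] A by blast
    then show "sorted_pair I J"
      unfolding sorted_pair_def using nz zero_notin_sorted_union[OF nz fin]
      by (metis not0_implies_Suc set_eqI)
  qed
qed

text \<open>The sum \<open>T\<close> of the counting function over the indices below
  \<open>n\<close> drops strictly from each member to the next. From the first member to any later
  one, however, each of the \<open>n - 1\<close> summands drops by at most 1.\<close>

lemma sorted_collection_length_le:
  assumes "sorted_collection k n Is" "0 < n"
  shows "length Is \<le> n"
proof (cases "Is = []")
  case False
  define T where "T s = (\<Sum>i\<in>{1..<n}. card_upto (Is ! s) i)" for s
  have mem: "Is ! s \<in> k_subsets k n" if "s < length Is" for s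
    using assms that by (auto simp: sorted_collection_def)
  have pair: "card_upto (Is ! t) i \<le> card_upto (Is ! s) i \<and>
      card_upto (Is ! s) i \<le> card_upto (Is ! t) i + 1" if "s < t" "t < length Is" for s t i
    using assms that sorted_pair_iff[OF mem mem, of s t] by (auto simp: sorted_collection_def)
  have dec: "T t < T s" if st: "s < t" "t < length Is" for s t
  proof -
    have "Is ! s \<noteq> Is ! t"
      using assms st by (simp add: sorted_collection_def nth_eq_iff_index_eq)
    then obtain i where "i \<in> {1..<n}" "card_upto (Is ! s) i \<noteq> card_upto (Is ! t) i"
      using k_subset_eqI[OF mem mem, of s t] st by auto
    then show ?thesis
      unfolding T_def using pair[OF st] by (intro sum_strict_mono_ex1) (auto intro!: bexI[of _ i] le_neq_trans)
  qed
  have up: "T s + s \<le> T 0" if "s < length Is" for s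
    using that
  proof (induction s)
    case (Suc s)
    then show ?case using dec[of s "Suc s"] by auto
  qed simp
  have down: "T 0 \<le> T s + (n - 1)" if "s < length Is" for s
  proof (cases "s = 0")
    case False
    have "T 0 \<le> (\<Sum>i\<in>{1..<n}. card_upto (Is ! s) i + 1)"
      unfolding T_def using pair[of 0 s] False that by (intro sum_mono) auto
    then show ?thesis
      by (simp only: T_def sum.distrib) simp
  qed simp
  have "length Is - 1 < length Is"
    using False by (cases Is) auto
  from up[OF this] down[OF this] show ?thesis
    using assms(2) by linarith
qed simp

lemma sorted_collection_maximalI:
  assumes "sorted_collection k n Is" "length Is = n" "0 < n"
  shows "maximal_sorted_collection k n Is"
proof -
  have False if Js: "sorted_collection k n Js" "set Is \<subset> set Js" for Js
  proof -
    have "card (set Is) < card (set Js)"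
      using Js by (auto intro: psubset_card_mono)
    moreover have "card (set Is) = length Is" "card (set Js) = length Js"
      using assms Js by (auto simp: sorted_collection_def distinct_card)
    ultimately show False
      using sorted_collection_length_le[OF Js(1)] assms by simp
  qed
  then show ?thesis
    using assms by (auto simp: maximal_sorted_collection_def)
qed

subsection \<open>Cells indexed by permutations\<close>

lemma z_coord_0 [simp]: "z_coord x 0 = 0"
  by (simp add: z_coord_def)

lemma z_coord_Suc: "z_coord x (Suc i) = z_coord x i + x (Suc i)"
  by (simp add: z_coord_def)

lemma linear_z_coord: "linear (\<lambda>x. z_coord x i)"
  by (rule linearI) (simp_all add: z_coord_def sum.distrib scaleR_fun_def sum_distrib_left)

lemmas z_coord_add = linear_add[OF linear_z_coord]
lemmas z_coord_scaleR = linear_scale[OF linear_z_coord, unfolded real_scaleR_def]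
lemmas z_coord_sum = linear_sum[OF linear_z_coord]

lemma coord_space_eqI:
  assumes "x \<in> coord_space m" "y \<in> coord_space m"
    and "\<And>i. i \<le> m \<Longrightarrow> z_coord x i = z_coord y i"
  shows "x = y"
proof
  fix i
  show "x i = y i"
  proof (cases "i \<in> {1..m}")
    case True
    then obtain j where "i = Suc j" "j < m" by (cases i) auto
    then show ?thesis
      using assms(3)[of j] assms(3)[of i] by (simp add: z_coord_Suc)
  next
    case False
    then show ?thesis using assms(1,2) by (auto simp: coord_space_def)
  qed
qed

lemma subspace_coord_space: "subspace (coord_space m)"
  by (auto simp: subspace_def coord_space_def scaleR_fun_def)

text \<open>The inverse change of coordinates, from prescribed partial sums \<open>Z\<close> with
  \<open>Z 0 = 0\<close> back to the point.\<close>

definition of_z :: "nat \<Rightarrow> (nat \<Rightarrow> real) \<Rightarrow> nat \<Rightarrow> real" where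
  "of_z m Z = (\<lambda>i. if i \<in> {1..m} then Z i - Z (i - 1) else 0)"

lemma of_z_mem: "of_z m Z \<in> coord_space m"
  by (auto simp: of_z_def coord_space_def)

lemma z_coord_of_z:
  assumes "Z 0 = 0" "i \<le> m"
  shows "z_coord (of_z m Z) i = Z i"
  using assms(2)
proof (induction i)
  case (Suc i)
  then show ?case by (simp add: z_coord_Suc) (simp add: of_z_def)
qed (simp add: assms)

lemma z_coord_eps:
  assumes "I \<in> k_subsets k n"
  shows "z_coord (eps I) i = real (card_upto I i)"
proof (induction i)
  case 0
  then show ?case by (simp add: card_upto_0[OF assms])
next
  case (Suc i)
  then show ?case
    by (simp add: z_coord_Suc card_upto_Suc finite_k_subset[OF assms] eps_def indicator_def)
qed

lemma linear_drop_last_coord: "linear (drop_last_coord n)"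
  by (rule linearI) (auto simp: drop_last_coord_def scaleR_fun_def)

lemma drop_last_coord_mem: "drop_last_coord (Suc m) x \<in> coord_space m"
  by (auto simp: drop_last_coord_def coord_space_def)

lemma z_coord_drop_last_coord:
  "i \<le> m \<Longrightarrow> z_coord (drop_last_coord (Suc m) x) i = z_coord x i"
  unfolding z_coord_def by (intro sum.cong) (auto simp: drop_last_coord_def)

lemma inj_eps: "inj eps"
  proof (rule injI)
  fix I J assume "eps I = eps J"
  then have "indicator I i = (indicator J i :: real)" for i
    by (simp add: eps_def)
  then show "I = J"
    by (metis indicator_simps zero_neq_one subsetI subset_antisym)
qed

section \<open>Descent counts and the subsets attached to a permutation\<close>

definition des :: "(nat \<Rightarrow> nat) \<Rightarrow> nat \<Rightarrow> nat" where
  "des u i = card {j. j < i \<and> u (Suc j) < u j}"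

lemma des_0 [simp]: "des u 0 = 0"
  by (simp add: des_def)

lemma des_Suc: "des u (Suc i) = des u i + (if u (Suc i) < u i then 1 else 0)"
proof -
  have "{j. j < Suc i \<and> u (Suc j) < u j} =
      (if u (Suc i) < u i then insert i {j. j < i \<and> u (Suc j) < u j} else {j. j < i \<and> u (Suc j) < u j})"
    by (auto simp: less_Suc_eq)
  then show ?thesis by (simp add: des_def)
qed

text \<open>The count \<open>des\<close> also admits the index \<open>j = 0\<close>, but
  \<open>u 0 = 0\<close> rules out a descent there.\<close>

lemma card_descents:
  assumes "u 0 = 0"
  shows "card (descents m u) = des u m"
proof -
  have "descents m u = {j. j < m \<and> u (Suc j) < u j}"
    using assms by (auto simp: descents_def; metis Suc_leI gr0I not_less0)
  then show ?thesis by (simp add: des_def)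
qed

lemma
  assumes "u permutes {1..m}"
  shows permutes_zero: "u 0 = 0" and permutes_Suc_top: "u (Suc m) = Suc m"
    and permutes_le_iff: "u i \<le> m \<longleftrightarrow> i \<le> m"
    and permutes_inv_le: "i \<le> m \<Longrightarrow> inv u i \<le> m"
proof -
  show z: "u 0 = 0" "u (Suc m) = Suc m"
    using assms by (auto simp: permutes_def)
  have le: "v i \<le> m \<longleftrightarrow> i \<le> m" if "v permutes {1..m}" for v i
    using permutes_in_image[OF that, of i] permutes_not_in[OF that, of i]
    by (cases "i \<in> {1..m}") auto
  show "u i \<le> m \<longleftrightarrow> i \<le> m" "i \<le> m \<Longrightarrow> inv u i \<le> m"
    using le[OF assms] le[OF permutes_inv[OF assms]] by auto
qed

text \<open>
  The cell of the rank permutation \<open>u = w\<^sup>-\<^sup>1\<close> has vertices indexed by \<open>s \<le> m\<close>; \<open>zvert u s i\<close> is the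
  \<open>i\<close>-th partial sum of the \<open>s\<close>-th vertex. As \<open>u (m + 1) = m + 1\<close>, the formula is also right at
  \<open>i = n = m + 1\<close>, where it gives \<open>k\<close>.
\<close>

definition zvert :: "(nat \<Rightarrow> nat) \<Rightarrow> nat \<Rightarrow> nat \<Rightarrow> nat" where
  "zvert u s i = des u i + (if s < u i then 1 else 0)"

text \<open>This recovers a set from its counting function: \<open>zvert u s\<close> starts at 0 if
  \<open>u 0 = 0\<close>, its steps are 0 or 1, and the elements of the set are the places where it
  jumps.\<close>

definition cell_set :: "nat \<Rightarrow> (nat \<Rightarrow> nat) \<Rightarrow> nat \<Rightarrow> nat set" where
  "cell_set n u s = {i \<in> {1..n}. zvert u s i \<noteq> zvert u s (i - 1)}"

text \<open>The indicator in \<open>zvert\<close> can fall only at a descent of \<open>u\<close>,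
  where \<open>des\<close> rises to compensate, and it can rise only at an ascent, where
  \<open>des\<close> is constant.\<close>

lemma zvert_Suc: "zvert u s i \<le> zvert u s (Suc i)" "zvert u s (Suc i) \<le> zvert u s i + 1"
  by (auto simp: zvert_def des_Suc)

lemma finite_cell_set: "finite (cell_set n u s)"
  by (simp add: cell_set_def)

lemma card_upto_cell_set:
  assumes "u 0 = 0" "i \<le> n"
  shows "card_upto (cell_set n u s) i = zvert u s i"
  using assms(2)
proof (induction i)
  case 0
  then show ?case by (auto simp: card_upto_def cell_set_def zvert_def assms)
next
  case (Suc i)
  then have "Suc i \<in> cell_set n u s \<longleftrightarrow> zvert u s (Suc i) \<noteq> zvert u s i"
    by (auto simp: cell_set_def)
  then show ?case
    using Suc zvert_Suc[of u s i] by (auto simp: card_upto_Suc finite_cell_set)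
qed

lemma des_Suc_top:
  assumes "u permutes {1..m}"
  shows "des u (Suc m) = des u m"
proof -
  have "u m \<le> m"
    using permutes_le_iff[OF assms] by blast
  then show ?thesis
    by (simp add: des_Suc permutes_Suc_top[OF assms])
qed

lemma zvert_top:
  assumes "u permutes {1..m}" "s \<le> m"
  shows "zvert u s (Suc m) = Suc (des u m)"
  using assms(2) by (simp add: zvert_def des_Suc_top[OF assms(1)] permutes_Suc_top[OF assms(1)])

lemma cell_set_mem:
  assumes u: "u permutes {1..m}" and s: "s \<le> m"
  shows "cell_set (Suc m) u s \<in> k_subsets (Suc (des u m)) (Suc m)"
proof -
  have "{j \<in> cell_set (Suc m) u s. j \<le> Suc m} = cell_set (Suc m) u s"
    by (auto simp: cell_set_def)
  then have "card (cell_set (Suc m) u s) = card_upto (cell_set (Suc m) u s) (Suc m)"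
    by (simp add: card_upto_def)
  also have "\<dots> = Suc (des u m)"
    by (simp add: card_upto_cell_set permutes_zero[OF u] zvert_top[OF u s])
  finally show ?thesis
    by (auto simp: k_subsets_def cell_set_def)
qed

section \<open>Open and closed cells\<close>

definition gap :: "(nat \<Rightarrow> nat) \<Rightarrow> (nat \<Rightarrow> real) \<Rightarrow> nat \<Rightarrow> real" where
  "gap u x i = z_coord x i - real (des u i)"

lemma gap_0 [simp]: "gap u x 0 = 0"
  by (simp add: gap_def)

text \<open>On this set \<open>gap\<close> is the fractional part of the partial sum, but written as
  an affine function of \<open>x\<close>; on the closed cell it may also reach 1. For each pair of
  indices the two inequalities describe the strip between consecutive parallel hyperplanes. The
  index 0, where the gap is 0, takes part as well and confines all gaps to the unit
  interval.\<close>

definition open_cell :: "nat \<Rightarrow> (nat \<Rightarrow> nat) \<Rightarrow> (nat \<Rightarrow> real) set" where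
  "open_cell m u = {x \<in> coord_space m. \<forall>i\<le>m. \<forall>j\<le>m. u i < u j \<longrightarrow>
     gap u x i < gap u x j \<and> gap u x j < gap u x i + 1}"

definition closed_cell :: "nat \<Rightarrow> (nat \<Rightarrow> nat) \<Rightarrow> (nat \<Rightarrow> real) set" where
  "closed_cell m u = {x \<in> coord_space m. \<forall>i\<le>m. \<forall>j\<le>m. u i < u j \<longrightarrow>
     gap u x i \<le> gap u x j \<and> gap u x j \<le> gap u x i + 1}"

lemma open_cell_subset_closed_cell: "open_cell m u \<subseteq> closed_cell m u"
  by (auto simp: open_cell_def closed_cell_def less_imp_le)

text \<open>The term \<open>des u i\<close> makes \<open>gap\<close> affine rather than linear, so
  the weights have to sum to 1.\<close>

lemma gap_convex_comb:
  "a + b = 1 \<Longrightarrow> gap u (a *\<^sub>R x + b *\<^sub>R y) i = a * gap u x i + b * gap u y i"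
proof -
  assume "a + b = 1"
  then have b: "b = 1 - a" by simp
  show ?thesis
    unfolding gap_def z_coord_add z_coord_scaleR b by (simp add: algebra_simps)
qed

lemma convex_closed_cell: "convex (closed_cell m u)"
proof (rule convexI)
  fix x y and a b :: real
  assume x: "x \<in> closed_cell m u" and y: "y \<in> closed_cell m u" and ab: "0 \<le> a" "0 \<le> b" "a + b = 1"
  have "a *\<^sub>R x + b *\<^sub>R y \<in> coord_space m"
    using x y by (intro subspace_add subspace_scale subspace_coord_space) (auto simp: closed_cell_def)
  moreover have "a * gap u x i + b * gap u y i \<le> a * gap u x j + b * gap u y j"
    "a * gap u x j + b * gap u y j \<le> a * gap u x i + b * gap u y i + 1"
    if "i \<le> m" "j \<le> m" "u i < u j" for i j
  proof -
    have "gap u x i \<le> gap u x j" "gap u y i \<le> gap u y j"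
      "gap u x j \<le> gap u x i + 1" "gap u y j \<le> gap u y i + 1"
      using x y that by (auto simp: closed_cell_def)
    note * = this[THEN mult_left_mono]
    show "a * gap u x i + b * gap u y i \<le> a * gap u x j + b * gap u y j"
      using *(1)[OF ab(1)] *(2)[OF ab(2)] by linarith
    show "a * gap u x j + b * gap u y j \<le> a * gap u x i + b * gap u y i + 1"
      using *(3)[OF ab(1)] *(4)[OF ab(2)] ab(3) by (simp add: distrib_left)
  qed
  ultimately show "a *\<^sub>R x + b *\<^sub>R y \<in> closed_cell m u"
    by (simp add: closed_cell_def gap_convex_comb[OF ab(3)])
qed

text \<open>A positive weight on the point of the open cell makes every inequality strict. Both the
  closure and the connectedness of the open cell rest on this.\<close>

lemma closed_open_convex_comb:
  assumes x: "x \<in> closed_cell m u" and y: "y \<in> open_cell m u" and ab: "0 \<le> a" "0 < b" "a + b = 1"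
  shows "a *\<^sub>R x + b *\<^sub>R y \<in> open_cell m u"
proof -
  have "a *\<^sub>R x + b *\<^sub>R y \<in> coord_space m"
    using x y by (intro subspace_add subspace_scale subspace_coord_space)
      (auto simp: closed_cell_def open_cell_def)
  moreover have "a * gap u x i + b * gap u y i < a * gap u x j + b * gap u y j"
    "a * gap u x j + b * gap u y j < a * gap u x i + b * gap u y i + 1"
    if "i \<le> m" "j \<le> m" "u i < u j" for i j
  proof -
    have 1: "gap u x i \<le> gap u x j" "gap u x j \<le> gap u x i + 1"
      using x that by (auto simp: closed_cell_def)
    have 2: "gap u y i < gap u y j" "gap u y j < gap u y i + 1"
      using y that by (auto simp: open_cell_def)
    note * = 1[THEN mult_left_mono, OF ab(1)] 2[THEN mult_strict_left_mono, OF ab(2)]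
    show "a * gap u x i + b * gap u y i < a * gap u x j + b * gap u y j"
      using *(1,3) by linarith
    show "a * gap u x j + b * gap u y j < a * gap u x i + b * gap u y i + 1"
      using *(2,4) ab(3) by (simp add: distrib_left)
  qed
  ultimately show ?thesis
    by (simp add: open_cell_def gap_convex_comb[OF ab(3)])
qed

lemma continuous_z_coord: "continuous_on A (\<lambda>x. z_coord x i)"
  unfolding z_coord_def
  by (intro continuous_on_sum continuous_on_subset[OF continuous_on_product_coordinates]) auto

lemma continuous_segment_fun:
  fixes x y :: "nat \<Rightarrow> real"
  shows "continuous_on A (\<lambda>t. (1 - t) *\<^sub>R x + t *\<^sub>R y)"
  by (rule continuous_on_coordinatewise_then_product)
    (auto simp: scaleR_fun_def intro!: continuous_intros)

lemma closed_coord_space: "closed (coord_space m)"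
proof -
  have "coord_space m = (\<Inter>i\<in>- {1..m}. {x. x i = 0})"
    by (auto simp: coord_space_def)
  then show ?thesis
    by (simp add: closed_Collect_eq closed_INT)
qed

lemma closed_closed_cell: "closed (closed_cell m u)"
proof -
  have c: "continuous_on UNIV (\<lambda>x. gap u x i)" for i
    unfolding gap_def by (intro continuous_intros continuous_z_coord)
  have "closed_cell m u = coord_space m \<inter>
      {x. \<forall>i j. i \<le> m \<longrightarrow> j \<le> m \<longrightarrow> u i < u j \<longrightarrow> gap u x i \<le> gap u x j \<and> gap u x j \<le> gap u x i + 1}"
    by (auto simp: closed_cell_def)
  also have "closed \<dots>"
    by (intro closed_Int closed_coord_space closed_Collect_all closed_Collect_imp closed_Collect_conj
        closed_Collect_le continuous_intros c open_Collect_const)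
  finally show ?thesis .
qed

lemma open_cell_nonempty:
  assumes u: "u permutes {1..m}"
  shows "open_cell m u \<noteq> {}"
proof -
  \<comment> \<open>The gaps of this point are equally spaced in the order of \<open>u\<close>; the
    largest is at most \<open>m / (m + 1)\<close>, hence below 1.\<close>
  define x where "x = of_z m (\<lambda>i. real (des u i) + real (u i) / real (Suc m))"
  have xm: "x \<in> coord_space m" by (simp add: x_def of_z_mem)
  have "gap u x i = real (u i) / real (Suc m)" if "i \<le> m" for i
    using that z_coord_of_z[of "\<lambda>i. real (des u i) + real (u i) / real (Suc m)" i m]
    by (simp add: gap_def x_def permutes_zero[OF u])
  note g = this
  have "gap u x i < gap u x j \<and> gap u x j < gap u x i + 1" if ij: "i \<le> m" "j \<le> m" "u i < u j" for i j
  proof -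
    have "u j \<le> m"
      using permutes_le_iff[OF u] ij by blast
    then show ?thesis
      unfolding g[OF ij(1)] g[OF ij(2)] using ij by (simp add: divide_simps)
  qed
  with xm have "x \<in> open_cell m u"
    by (simp add: open_cell_def)
  then show ?thesis by blast
qed

text \<open>A point of the closed cell is the limit of the points on the segment from it to a fixed
  point of the open cell, all of which lie in the open cell.\<close>

lemma closure_open_cell:
  assumes u: "u permutes {1..m}"
  shows "closure (open_cell m u) = closed_cell m u"
proof
  show "closure (open_cell m u) \<subseteq> closed_cell m u"
    by (intro closure_minimal open_cell_subset_closed_cell closed_closed_cell)
  obtain y where y: "y \<in> open_cell m u"
    using open_cell_nonempty[OF u] by blast
  show "closed_cell m u \<subseteq> closure (open_cell m u)"
  proof
    fix x assume x: "x \<in> closed_cell m u"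
    let ?f = "\<lambda>t. (1 - t) *\<^sub>R x + t *\<^sub>R y"
    have "?f ` {0<..<1} \<subseteq> open_cell m u"
      using closed_open_convex_comb[OF x y] by auto
    then have "?f ` closure {0<..<1::real} \<subseteq> closure (open_cell m u)"
      by (intro image_closure_subset continuous_segment_fun closed_closure)
        (use closure_subset in blast)
    moreover have "0 \<in> closure {0<..<1::real}" by simp
    ultimately have "?f 0 \<in> closure (open_cell m u)" by blast
    then show "x \<in> closure (open_cell m u)" by simp
  qed
qed

lemma connected_open_cell: "connected (open_cell m u)"
proof -
  have "\<exists>T. connected T \<and> T \<subseteq> open_cell m u \<and> x \<in> T \<and> y \<in> T"
    if xy: "x \<in> open_cell m u" "y \<in> open_cell m u" for x y
  proof (intro exI conjI)
    let ?f = "\<lambda>t. (1 - t) *\<^sub>R x + t *\<^sub>R y"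
    show "connected (?f ` {0..1})"
      by (intro connected_continuous_image continuous_segment_fun) simp
    have "?f t \<in> open_cell m u" if "t \<in> {0..1}" for t
    \<comment> \<open>At \<open>t = 0\<close> the second endpoint has weight 0, so
      \<open>closed_open_convex_comb\<close> does not apply.\<close>
    proof (cases "t = 0")
      case False
      have "x \<in> closed_cell m u"
        using xy open_cell_subset_closed_cell by blast
      then show ?thesis
        using closed_open_convex_comb[OF _ xy(2), of x "1 - t" t] False that by auto
    qed (simp add: xy)
    then show "?f ` {0..1} \<subseteq> open_cell m u" by blast
    show "x \<in> ?f ` {0..1}" by (rule image_eqI[of _ _ 0]) auto
    show "y \<in> ?f ` {0..1}" by (rule image_eqI[of _ _ 1]) auto
  qed
  then show ?thesis
    by (intro connected_iff_connected_component[THEN iffD2] ballI) (simp add: connected_component_def)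
qed

section \<open>The vertices of a cell\<close>

definition cell_vertex :: "nat \<Rightarrow> (nat \<Rightarrow> nat) \<Rightarrow> nat \<Rightarrow> nat \<Rightarrow> real" where
  "cell_vertex m u s = drop_last_coord (Suc m) (eps (cell_set (Suc m) u s))"

lemma z_coord_cell_vertex:
  assumes "u permutes {1..m}" "s \<le> m" "i \<le> m"
  shows "z_coord (cell_vertex m u s) i = real (zvert u s i)"
  using assms by (simp add: cell_vertex_def z_coord_drop_last_coord z_coord_eps[OF cell_set_mem]
      card_upto_cell_set permutes_zero[OF assms(1)])

lemma cell_vertex_mem: "cell_vertex m u s \<in> coord_space m"
  by (simp add: cell_vertex_def drop_last_coord_mem)

lemma gap_cell_vertex:
  assumes "u permutes {1..m}" "s \<le> m" "i \<le> m"
  shows "gap u (cell_vertex m u s) i = (if s < u i then 1 else 0)"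
  using assms by (simp add: gap_def z_coord_cell_vertex zvert_def)

text \<open>Listed in the order of \<open>u\<close>, the gaps of \<open>x\<close> increase weakly
  from 0 to at most 1. Their consecutive differences are the barycentric coordinates of
  \<open>x\<close>: the gap of vertex \<open>s\<close> at \<open>i\<close> is 1 exactly if
  \<open>s < u i\<close>, so the weights below \<open>u i\<close> telescope to the gap of
  \<open>x\<close> at \<open>i\<close>.\<close>

lemma closed_cell_eq_hull:
  assumes u: "u permutes {1..m}"
  shows "closed_cell m u = convex hull (cell_vertex m u ` {..m})"
proof
  have "cell_vertex m u s \<in> closed_cell m u" if "s \<le> m" for s
    using that by (auto simp: closed_cell_def cell_vertex_mem gap_cell_vertex[OF u])
  then show "convex hull (cell_vertex m u ` {..m}) \<subseteq> closed_cell m u"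
    by (intro hull_minimal convex_closed_cell) auto
  show "closed_cell m u \<subseteq> convex hull (cell_vertex m u ` {..m})"
  proof
    fix x assume x: "x \<in> closed_cell m u"
    \<comment> \<open>\<open>G r\<close> is the gap at the index of rank \<open>r\<close>. The value
      1 beyond rank \<open>m\<close> closes the chain and makes the weights sum to 1.\<close>
    define G where "G r = (if r \<le> m then gap u x (inv u r) else 1)" for r
    define c where "c s = G (Suc s) - G s" for s
    have inv: "u (inv u s) = s" "inv u (u s) = s" for s
      using permutes_inverses[OF u] by auto
    have inv0: "inv u 0 = 0"
      using inv(2)[of 0] permutes_zero[OF u] by simp
    have G0: "G 0 = 0" by (simp add: G_def inv0)
    have Gu: "G (u i) = gap u x i" if "i \<le> m" for i
      using that permutes_le_iff[OF u, of i] by (simp add: G_def inv)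
    have nonneg: "0 \<le> c s" if "s \<le> m" for s
    proof (cases "s < m")
      case True
      then show ?thesis
        using x permutes_inv_le[OF u, of s] permutes_inv_le[OF u, of "Suc s"]
        by (auto simp: c_def G_def closed_cell_def inv)
    next
      case False
      then have s: "s = m" using that by simp
      show ?thesis
      \<comment> \<open>The last weight is nonnegative by the upper bound relative to index 0. For
        \<open>m = 0\<close> that pair of indices degenerates, but the only gap is 0.\<close>
      proof (cases "m = 0")
        case True
        then show ?thesis by (simp add: c_def G_def s inv0)
      next
        case False
        then have "gap u x (inv u m) \<le> gap u x 0 + 1"
          using x permutes_inv_le[OF u, of m] permutes_zero[OF u]
          unfolding closed_cell_def by (simp add: inv del: gap_0)
        then show ?thesis by (simp add: c_def G_def s)
      qed
    qed
    have csum: "(\<Sum>s<r. c s) = G r" for r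
      by (simp add: c_def sum_lessThan_telescope G0)
    have total: "(\<Sum>s\<le>m. c s) = 1"
      using csum[of "Suc m"] by (simp add: lessThan_Suc_atMost G_def)
    have "x = (\<Sum>s\<le>m. c s *\<^sub>R cell_vertex m u s)"
    proof (rule coord_space_eqI)
      show "x \<in> coord_space m" using x by (simp add: closed_cell_def)
      show "(\<Sum>s\<le>m. c s *\<^sub>R cell_vertex m u s) \<in> coord_space m"
        by (intro subspace_sum subspace_scale subspace_coord_space cell_vertex_mem)
      fix i assume i: "i \<le> m"
      have "z_coord (\<Sum>s\<le>m. c s *\<^sub>R cell_vertex m u s) i = (\<Sum>s\<le>m. c s * real (zvert u s i))"
        using i by (auto simp: z_coord_sum z_coord_scaleR z_coord_cell_vertex[OF u] intro!: sum.cong)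
      also have "\<dots> = (\<Sum>s\<le>m. c s * real (des u i) + (if s < u i then c s else 0))"
        by (intro sum.cong) (auto simp: zvert_def algebra_simps)
      also have "\<dots> = real (des u i) + (\<Sum>s\<le>m. if s < u i then c s else 0)"
        by (simp add: sum.distrib total flip: sum_distrib_right)
      also have "(\<Sum>s\<le>m. if s < u i then c s else 0) = (\<Sum>s<u i. c s)"
        using permutes_le_iff[OF u, of i] i
        by (intro sum.mono_neutral_cong_right) auto
      also have "real (des u i) + (\<Sum>s<u i. c s) = z_coord x i"
        using csum[of "u i"] Gu[OF i] by (simp add: gap_def)
      finally show "z_coord x i = z_coord (\<Sum>s\<le>m. c s *\<^sub>R cell_vertex m u s) i" ..
    qed
    also have "\<dots> \<in> convex hull (cell_vertex m u ` {..m})"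
      using nonneg total by (intro convex_sum convex_convex_hull) (auto intro: hull_inc)
    finally show "x \<in> convex hull (cell_vertex m u ` {..m})" .
  qed
qed

lemma inj_on_cell_vertex:
  assumes u: "u permutes {1..m}"
  shows "inj_on (cell_vertex m u) {..m}"
proof (rule linorder_inj_onI)
  fix s t assume st: "s < t" "s \<in> {..m}" "t \<in> {..m}"
  then have "gap u (cell_vertex m u s) (inv u t) \<noteq> gap u (cell_vertex m u t) (inv u t)"
    using permutes_inv_le[OF u, of t] permutes_inverses[OF u] by (simp add: gap_cell_vertex[OF u])
  then show "cell_vertex m u s \<noteq> cell_vertex m u t" by auto
qed auto

text \<open>Evaluate an affine relation at the partial sum whose index has rank \<open>r\<close>.
  The \<open>des\<close> terms cancel because the coefficients sum to 0, which leaves the sum of the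
  coefficients below \<open>r\<close>. As all these sums vanish, so does each coefficient.\<close>

lemma affine_independent_cell_vertices:
  assumes u: "u permutes {1..m}"
  shows "\<not> affine_dependent (cell_vertex m u ` {..m})"
proof
  assume "affine_dependent (cell_vertex m u ` {..m})"
  then obtain U where U: "sum U (cell_vertex m u ` {..m}) = 0" "\<exists>v\<in>cell_vertex m u ` {..m}. U v \<noteq> 0"
      "(\<Sum>v\<in>cell_vertex m u ` {..m}. U v *\<^sub>R v) = 0"
    by (auto simp: affine_dependent_explicit_finite)
  define c where "c s = U (cell_vertex m u s)" for s
  note re = sum.reindex[OF inj_on_cell_vertex[OF u]]
  have c0: "(\<Sum>s\<le>m. c s) = 0" and cv: "(\<Sum>s\<le>m. c s *\<^sub>R cell_vertex m u s) = 0"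
    using U(1,3) by (simp_all add: re c_def)
  have part: "(\<Sum>s<r. c s) = 0" if "r \<le> m" for r
  proof -
    define i where "i = inv u r"
    have i: "i \<le> m" "u i = r"
      using permutes_inv_le[OF u that] permutes_inverses[OF u] by (auto simp: i_def)
    have "0 = z_coord (\<Sum>s\<le>m. c s *\<^sub>R cell_vertex m u s) i"
      unfolding cv using linear_0[OF linear_z_coord] by simp
    also have "\<dots> = (\<Sum>s\<le>m. c s * real (zvert u s i))"
      using i by (auto simp: z_coord_sum z_coord_scaleR z_coord_cell_vertex[OF u] intro!: sum.cong)
    also have "\<dots> = (\<Sum>s\<le>m. c s * real (des u i) + (if s < r then c s else 0))"
      by (intro sum.cong) (auto simp: zvert_def algebra_simps i)
    also have "\<dots> = (\<Sum>s\<le>m. if s < r then c s else 0)"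
      by (simp add: sum.distrib c0 flip: sum_distrib_right)
    also have "\<dots> = (\<Sum>s<r. c s)"
      using that by (intro sum.mono_neutral_cong_right) auto
    finally show ?thesis by simp
  qed
  have "c s = 0" if "s \<le> m" for s
  proof (cases "s < m")
    case True
    then show ?thesis using part[of s] part[of "Suc s"] by simp
  next
    case False
    then have "s = m" using that by simp
    then show ?thesis using part[of m] c0 by (simp flip: lessThan_Suc_atMost)
  qed
  then show False using U(2) by (auto simp: c_def)
qed

lemma is_simplex_closed_cell:
  assumes "u permutes {1..m}"
  shows "is_simplex m (closed_cell m u)"
  unfolding is_simplex_def
  using affine_independent_cell_vertices[OF assms] closed_cell_eq_hull[OF assms]
    card_image[OF inj_on_cell_vertex[OF assms]]
  by (intro exI[of _ "cell_vertex m u ` {..m}"]) auto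

subsection \<open>Stanley's regions and alcoves\<close>

lemma permutes_eq_iff: "u permutes S \<Longrightarrow> u i = u j \<longleftrightarrow> i = j"
  using permutes_inj inj_eq by metis

lemma permutes_zero_less:
  fixes u :: "nat \<Rightarrow> nat"
  assumes "u permutes {1..m}" "i \<noteq> 0"
  shows "u 0 < u i"
  using permutes_zero[OF assms(1)] permutes_eq_iff[OF assms(1), of i 0] assms(2) by simp

lemma proj_hypersimplex_iff:
  "x \<in> proj_hypersimplex k (Suc m) \<longleftrightarrow>
    x \<in> unit_cube m \<and> real k - 1 \<le> z_coord x m \<and> z_coord x m \<le> real k"
  by (simp add: proj_hypersimplex_def z_coord_def)

lemma unit_cube_SucD:
  assumes "x \<in> unit_cube m" "Suc i \<le> m"
  shows "0 \<le> x (Suc i)" "x (Suc i) \<le> 1"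
  using assms by (auto simp: unit_cube_def)

lemma unit_cubeI:
  assumes "x \<in> coord_space m" "\<And>i. Suc i \<le> m \<Longrightarrow> 0 \<le> x (Suc i) \<and> x (Suc i) \<le> 1"
  shows "x \<in> unit_cube m"
proof -
  have "0 \<le> x i \<and> x i \<le> 1" if "i \<in> {1..m}" for i
    using that assms(2)[of "i - 1"] by auto
  then show ?thesis using assms(1) by (simp add: unit_cube_def)
qed

lemma convex_proj_hypersimplex: "convex (proj_hypersimplex k (Suc m))"
proof (rule convexI)
  have bounds: "l \<le> a * p + b * q \<and> a * p + b * q \<le> h"
    if "0 \<le> a" "0 \<le> b" "a + b = 1" "l \<le> p" "p \<le> h" "l \<le> q" "q \<le> h" for a b p q l h :: real
    using that convex_bound_le[of p h q a b] convex_bound_le[of "- p" "- l" "- q" a b] by simp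
  fix x y and a b :: real
  assume xy: "x \<in> proj_hypersimplex k (Suc m)" "y \<in> proj_hypersimplex k (Suc m)"
    and ab: "0 \<le> a" "0 \<le> b" "a + b = 1"
  have cs: "x \<in> coord_space m" "y \<in> coord_space m"
    using xy by (auto simp: proj_hypersimplex_iff unit_cube_def)
  show "a *\<^sub>R x + b *\<^sub>R y \<in> proj_hypersimplex k (Suc m)"
    unfolding proj_hypersimplex_iff z_coord_add z_coord_scaleR
  proof (intro conjI unit_cubeI)
    show "a *\<^sub>R x + b *\<^sub>R y \<in> coord_space m"
      using cs by (intro subspace_add subspace_scale subspace_coord_space)
    show "real k - 1 \<le> a * z_coord x m + b * z_coord y m"
      and "a * z_coord x m + b * z_coord y m \<le> real k"
      using bounds[OF ab] xy by (auto simp: proj_hypersimplex_iff)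
    fix i assume "Suc i \<le> m"
    then show "0 \<le> (a *\<^sub>R x + b *\<^sub>R y) (Suc i)" "(a *\<^sub>R x + b *\<^sub>R y) (Suc i) \<le> 1"
      using bounds[OF ab, of 0 "x (Suc i)" 1 "y (Suc i)"] xy
      by (auto simp: proj_hypersimplex_iff unit_cube_SucD scaleR_fun_def)
  qed
qed

text \<open>A coordinate of \<open>x\<close> is a difference of two consecutive gaps, plus 1 at a
  descent of \<open>u\<close>; the inequalities of the cell place it in the unit interval. The gap
  at \<open>m\<close> lies there too, which bounds the sum of all coordinates.\<close>

lemma closed_cell_subset_proj_hypersimplex:
  assumes u: "u permutes {1..m}"
  shows "closed_cell m u \<subseteq> proj_hypersimplex (Suc (des u m)) (Suc m)"
proof
  fix x assume x: "x \<in> closed_cell m u"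
  have ord: "gap u x i \<le> gap u x j" "gap u x j \<le> gap u x i + 1"
    if "i \<le> m" "j \<le> m" "u i < u j" for i j
    using x that by (auto simp: closed_cell_def)
  have "x \<in> unit_cube m"
  proof (rule unit_cubeI)
    show "x \<in> coord_space m" using x by (simp add: closed_cell_def)
    fix i assume i: "Suc i \<le> m"
    have "u i \<noteq> u (Suc i)"
      by (simp add: permutes_eq_iff[OF u])
    moreover have "x (Suc i) = gap u x (Suc i) - gap u x i + (if u (Suc i) < u i then 1 else 0)"
      by (simp add: gap_def z_coord_Suc des_Suc)
    ultimately show "0 \<le> x (Suc i) \<and> x (Suc i) \<le> 1"
      using ord[of i "Suc i"] ord[of "Suc i" i] i by (cases "u i < u (Suc i)") auto
  qed
  moreover have "0 \<le> gap u x m" "gap u x m \<le> 1"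
  proof -
    have "m = 0 \<or> u 0 < u m"
      using permutes_zero_less[OF u, of m] by blast
    then show "0 \<le> gap u x m" "gap u x m \<le> 1"
      using ord[of 0 m] by auto
  qed
  ultimately show "x \<in> proj_hypersimplex (Suc (des u m)) (Suc m)"
    by (simp add: proj_hypersimplex_iff gap_def)
qed

text \<open>Consecutive partial sums differ by a number between 0 and 1, so the integer part goes up
  by 1 where the fractional part falls and stays put where it rises. The order of the fractional
  parts thus forces the integer parts to be \<open>des u\<close>, and the upper bounds in
  \<open>open_cell\<close> hold because fractional parts differ by less than 1.\<close>

lemma open_cell_iff:
  assumes u: "u permutes {1..m}"
  shows "x \<in> open_cell m u \<longleftrightarrow> x \<in> unit_cube m \<and>
    (\<forall>i\<le>m. \<forall>j\<le>m. u i < u j \<longrightarrow> frac (z_coord x i) < frac (z_coord x j))"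
proof
  assume x: "x \<in> open_cell m u"
  have cube: "x \<in> unit_cube m"
    using x open_cell_subset_closed_cell closed_cell_subset_proj_hypersimplex[OF u]
    by (auto simp: proj_hypersimplex_iff subset_iff)
  have ord: "gap u x i < gap u x j" "gap u x j < gap u x i + 1"
    if "i \<le> m" "j \<le> m" "u i < u j" for i j
    using x that by (auto simp: open_cell_def)
  have "frac (z_coord x i) = gap u x i" if i: "i \<le> m" for i
  proof -
    have "i = 0 \<or> u 0 < u i"
      using permutes_zero_less[OF u, of i] by blast
    then have "0 \<le> gap u x i \<and> gap u x i < 1"
      using ord[of 0 i] i by auto
    then show ?thesis
      by (simp add: frac_unique_iff) (simp add: gap_def)
  qed
  then show "x \<in> unit_cube m \<and>
      (\<forall>i\<le>m. \<forall>j\<le>m. u i < u j \<longrightarrow> frac (z_coord x i) < frac (z_coord x j))"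
    using cube ord by simp
next
  assume A: "x \<in> unit_cube m \<and>
    (\<forall>i\<le>m. \<forall>j\<le>m. u i < u j \<longrightarrow> frac (z_coord x i) < frac (z_coord x j))"
  have floor: "\<lfloor>z_coord x i\<rfloor> = int (des u i)" if "i \<le> m" for i
    using that
  proof (induction i)
    case (Suc i)
    define d where "d = \<lfloor>z_coord x (Suc i)\<rfloor> - \<lfloor>z_coord x i\<rfloor>"
    have "u i \<noteq> u (Suc i)"
      by (simp add: permutes_eq_iff[OF u])
    then have cs: "(u i < u (Suc i) \<and> frac (z_coord x i) < frac (z_coord x (Suc i))) \<or>
      (u (Suc i) < u i \<and> frac (z_coord x (Suc i)) < frac (z_coord x i))"
      using A Suc.prems by (metis Suc_leD linorder_neqE_nat)
    have e: "real_of_int d + frac (z_coord x (Suc i)) - frac (z_coord x i) = x (Suc i)"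
      by (simp add: d_def frac_def z_coord_Suc)
    have b: "0 \<le> x (Suc i)" "x (Suc i) \<le> 1"
      using A unit_cube_SucD Suc.prems by blast+
    have f: "frac (z_coord x (Suc i)) < 1" "frac (z_coord x i) < 1"
      "0 \<le> frac (z_coord x (Suc i))" "0 \<le> frac (z_coord x i)"
      by (simp_all add: frac_lt_1)
    from cs have "d = (if u (Suc i) < u i then 1 else 0)"
    proof
      assume 1: "u i < u (Suc i) \<and> frac (z_coord x i) < frac (z_coord x (Suc i))"
      then have "real_of_int d < 1" "real_of_int d > - 1"
        using b e f by linarith+
      then show ?thesis using 1 by auto
    next
      assume 2: "u (Suc i) < u i \<and> frac (z_coord x (Suc i)) < frac (z_coord x i)"
      then have "real_of_int d < 2" "real_of_int d > 0"
        using b e f by linarith+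
      then show ?thesis using 2 by auto
    qed
    then show ?case
      using Suc by (simp add: d_def des_Suc split: if_splits)
  qed simp
  then have "gap u x i = frac (z_coord x i)" if "i \<le> m" for i
    using that by (simp add: gap_def frac_def)
  moreover have "frac a < frac b + 1" for a b :: real
    using frac_lt_1[of a] frac_ge_0[of b] by linarith
  ultimately show "x \<in> open_cell m u"
    using A by (simp add: open_cell_def unit_cube_def)
qed

text \<open>\<open>w\<close> lists the indices by increasing fractional part, so
  \<open>inv w\<close> assigns the ranks.\<close>

lemma stanley_region_eq_open_cell:
  assumes w: "w permutes {1..m}" and m: "1 \<le> m"
  shows "{x \<in> unit_cube m. stanley_map m x \<in> perm_region m w} = open_cell m (inv w)"
proof -
  have "stanley_map m x \<in> perm_region m w \<longleftrightarrow>
    (\<forall>i\<le>m. \<forall>j\<le>m. inv w i < inv w j \<longrightarrow> frac (z_coord x i) < frac (z_coord x j))" for x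
  proof -
    define h where "h r = frac (z_coord x (w r))" for r
    have h0: "h 0 = 0"
      by (simp add: h_def permutes_zero[OF w])
    have st: "stanley_map m x (w r) = h r" if "r \<in> {1..m}" for r
      using permutes_in_image[OF w, of r] that by (simp add: stanley_map_def h_def z_coord_def)
    have cube: "stanley_map m x \<in> unit_cube m"
      by (auto simp: unit_cube_def coord_space_def stanley_map_def frac_lt_1 less_imp_le)
    have "stanley_map m x \<in> perm_region m w \<longleftrightarrow> 0 < h 1 \<and> (\<forall>r\<in>{1..<m}. h r < h (r + 1)) \<and> h m < 1"
      using cube m by (simp add: perm_region_def st)
    \<comment> \<open>Since \<open>h 0 = 0\<close>, the condition \<open>0 < h 1\<close> becomes the
      step at \<open>r = 0\<close>; and \<open>h m < 1\<close> holds for every fractional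
      part.\<close>
    also have "\<dots> \<longleftrightarrow> (\<forall>r<m. h r < h (Suc r))"
    proof
      assume L: "0 < h 1 \<and> (\<forall>r\<in>{1..<m}. h r < h (r + 1)) \<and> h m < 1"
      then show "\<forall>r<m. h r < h (Suc r)"
        using h0 by (metis One_nat_def Suc_eq_plus1 Suc_leI atLeastLessThan_iff gr0I)
    next
      assume "\<forall>r<m. h r < h (Suc r)"
      moreover have "h m < 1" by (simp add: h_def frac_lt_1)
      ultimately show "0 < h 1 \<and> (\<forall>r\<in>{1..<m}. h r < h (r + 1)) \<and> h m < 1"
        using m h0 by (metis One_nat_def Suc_eq_plus1 Suc_le_lessD atLeastLessThan_iff)
    qed
    also have "\<dots> \<longleftrightarrow> (\<forall>s\<le>m. \<forall>r<s. h r < h s)"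
    proof
      assume step: "\<forall>r<m. h r < h (Suc r)"
      have "h r < h s" if "r < s" "s \<le> m" for r s
        using that
      proof (induction s)
        case (Suc s)
        then show ?case using step by (cases "r = s") (force intro: less_trans)+
      qed simp
      then show "\<forall>s\<le>m. \<forall>r<s. h r < h s" by blast
    qed auto
    also have "\<dots> \<longleftrightarrow>
      (\<forall>i\<le>m. \<forall>j\<le>m. inv w i < inv w j \<longrightarrow> frac (z_coord x i) < frac (z_coord x j))"
    proof (intro iffI allI impI)
      fix i j assume H: "\<forall>s\<le>m. \<forall>r<s. h r < h s" and ij: "i \<le> m" "j \<le> m" "inv w i < inv w j"
      then have "h (inv w i) < h (inv w j)"
        using permutes_inv_le[OF w, of j] by blast
      then show "frac (z_coord x i) < frac (z_coord x j)"
        by (simp add: h_def permutes_inverses[OF w])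
    next
      fix s r assume H: "\<forall>i\<le>m. \<forall>j\<le>m. inv w i < inv w j \<longrightarrow> frac (z_coord x i) < frac (z_coord x j)"
        and "s \<le> m" "r < s"
      then show "h r < h s"
        using permutes_le_iff[OF w, of r] permutes_le_iff[OF w, of s]
        by (simp add: h_def permutes_inverses[OF w])
    qed
    finally show ?thesis .
  qed
  then show ?thesis
    by (auto simp: open_cell_iff[OF permutes_inv[OF w]])
qed

section \<open>Generic points and their connected components\<close>

definition generic_points :: "nat \<Rightarrow> (nat \<Rightarrow> real) set" where
  "generic_points m = {x \<in> coord_space m. \<forall>i j. i < j \<and> j \<le> m \<longrightarrow> z_coord x i - z_coord x j \<notin> \<int>}"

lemma alcove_complement_eq:
  "coord_space m - \<Union>{alcove_hyperplane m i j l | i j l. i < j \<and> j \<le> m} = generic_points m"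
  unfolding generic_points_def alcove_hyperplane_def Ints_def by blast

lemma generic_points_neqD:
  assumes "x \<in> generic_points m" "i \<le> m" "j \<le> m" "i \<noteq> j"
  shows "z_coord x i - z_coord x j \<notin> \<int>"
proof (cases "i < j")
  case True
  then show ?thesis using assms by (simp add: generic_points_def)
next
  case False
  then have "z_coord x j - z_coord x i \<notin> \<int>"
    using assms by (simp add: generic_points_def)
  then show ?thesis by (metis Ints_minus minus_diff_eq)
qed

text \<open>Genericity makes the fractional parts of the partial sums distinct, and \<open>u\<close>
  ranks them. The integer part of the last partial sum is then the number of descents; since this
  sum lies strictly between consecutive integers and in the interval from \<open>k - 1\<close> to
  \<open>k\<close>, that number is \<open>k - 1\<close>.\<close>

lemma exists_open_cell:
  assumes x: "x \<in> proj_hypersimplex k (Suc m)" and gen: "x \<in> generic_points m" and m: "1 \<le> m" and k: "0 < k"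
  obtains u where "u permutes {1..m}" "Suc (des u m) = k" "x \<in> open_cell m u"
proof -
  define f where "f i = frac (z_coord x i)" for i
  have f_inj: "i = j" if "f i = f j" "i \<le> m" "j \<le> m" for i j
  proof (rule ccontr)
    assume "i \<noteq> j"
    moreover have "z_coord x i - z_coord x j = of_int (\<lfloor>z_coord x i\<rfloor> - \<lfloor>z_coord x j\<rfloor>)"
      using that(1) by (simp add: f_def frac_def)
    ultimately show False
      using generic_points_neqD[OF gen that(2,3)] by (metis Ints_of_int)
  qed
  define u where "u i = (if i \<in> {1..m} then card {j \<in> {1..m}. f j \<le> f i} else i)" for i
  have mono: "u i < u j" if "i \<in> {1..m}" "j \<in> {1..m}" "f i < f j" for i j
  proof -
    have "{l \<in> {1..m}. f l \<le> f i} \<subset> {l \<in> {1..m}. f l \<le> f j}"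
    proof
      show "{l \<in> {1..m}. f l \<le> f i} \<subseteq> {l \<in> {1..m}. f l \<le> f j}"
        using that(3) by auto
      have "j \<in> {l \<in> {1..m}. f l \<le> f j}" "j \<notin> {l \<in> {1..m}. f l \<le> f i}"
        using that by auto
      then show "{l \<in> {1..m}. f l \<le> f i} \<noteq> {l \<in> {1..m}. f l \<le> f j}" by metis
    qed
    then have "card {l \<in> {1..m}. f l \<le> f i} < card {l \<in> {1..m}. f l \<le> f j}"
      by (intro psubset_card_mono) auto
    then show ?thesis using that by (simp add: u_def)
  qed
  have "inj_on u {1..m}"
  proof (rule inj_onI)
    fix i j assume ij: "i \<in> {1..m}" "j \<in> {1..m}" "u i = u j"
    then have "f i = f j"
      using mono[of i j] mono[of j i] by linarith
    then show "i = j" using f_inj ij by auto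
  qed
  moreover have "u ` {1..m} \<subseteq> {1..m}"
  proof
    fix a assume "a \<in> u ` {1..m}"
    then obtain i where i: "i \<in> {1..m}" "a = card {j \<in> {1..m}. f j \<le> f i}"
      by (auto simp: u_def)
    have "card {j \<in> {1..m}. f j \<le> f i} \<le> card {1..m}"
      by (intro card_mono) auto
    moreover have "card {j \<in> {1..m}. f j \<le> f i} > 0"
      using i by (auto simp: card_gt_0_iff)
    ultimately show "a \<in> {1..m}" using i by auto
  qed
  ultimately have "bij_betw u {1..m} {1..m}"
    by (simp add: bij_betw_def endo_inj_surj)
  then have u: "u permutes {1..m}"
    by (rule bij_imp_permutes) (simp only: u_def if_False)
  have ord: "f i < f j" if ij: "i \<le> m" "j \<le> m" "u i < u j" for i j
  proof (rule ccontr)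
    assume "\<not> f i < f j"
    moreover have "i \<noteq> j" using ij by auto
    ultimately have lt: "f j < f i"
      using f_inj[of i j] ij by fastforce
    \<comment> \<open>\<open>mono\<close> covers only the indices from 1 to \<open>m\<close>. Index
      0 is handled by its fractional part 0, which no other can undercut, and by its rank 0.\<close>
    have "f 0 = 0" "0 \<le> f j" by (simp_all add: f_def)
    then have "i \<noteq> 0" using lt by (metis not_less)
    moreover have "j \<noteq> 0" using ij permutes_zero[OF u] by (metis not_less0)
    ultimately show False
      using mono[of j i] lt ij by auto
  qed
  then have mem: "x \<in> open_cell m u"
    using x by (simp add: open_cell_iff[OF u] f_def proj_hypersimplex_iff)
  moreover have "Suc (des u m) = k"
  proof -
    have "u 0 < u m"
      using permutes_zero_less[OF u, of m] m by simp
    then have "0 < gap u x m" "gap u x m < 1"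
      using mem m by (auto simp: open_cell_def)
    then have "real (des u m) < z_coord x m" "z_coord x m < real (des u m) + 1"
      by (simp_all add: gap_def)
    moreover have "real k - 1 \<le> z_coord x m" "z_coord x m \<le> real k"
      using x by (auto simp: proj_hypersimplex_iff)
    ultimately have "real (des u m) < real k" "real k < real (des u m) + 2"
      by linarith+
    then show ?thesis by linarith
  qed
  ultimately show ?thesis using that u by blast
qed

lemma gap_diff_in_Ints_iff: "gap u x j - gap u x i \<in> \<int> \<longleftrightarrow> z_coord x j - z_coord x i \<in> \<int>"
proof -
  have "gap u x j - gap u x i = z_coord x j - z_coord x i + of_int (int (des u i) - int (des u j))"
    by (simp add: gap_def)
  then show ?thesis by (metis Ints_add Ints_diff Ints_of_int add_diff_cancel_right')
qed

lemma open_cell_subset_generic_points: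
  assumes u: "u permutes {1..m}"
  shows "open_cell m u \<subseteq> generic_points m"
proof
  fix x assume x: "x \<in> open_cell m u"
  have *: "z_coord x j - z_coord x i \<notin> \<int>" if "i \<le> m" "j \<le> m" "u i < u j" for i j
  proof -
    have "0 < gap u x j - gap u x i" "gap u x j - gap u x i < 1"
      using x that by (auto simp: open_cell_def) force
    then have "gap u x j - gap u x i \<notin> \<int>"
      by (auto elim!: Ints_cases)
    then show ?thesis by (simp add: gap_diff_in_Ints_iff)
  qed
  have "z_coord x i - z_coord x j \<notin> \<int>" if "i < j" "j \<le> m" for i j
  proof -
    have "u i \<noteq> u j"
      using that by (simp add: permutes_eq_iff[OF u])
    then consider "u i < u j" | "u j < u i" by linarith
    then show ?thesis
      using *[of i j] *[of j i] that by cases (metis Ints_minus minus_diff_eq less_imp_le le_trans)+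
  qed
  then show "x \<in> generic_points m"
    using x by (auto simp: generic_points_def open_cell_def)
qed

text \<open>On a connected set \<open>D\<close> of generic points the difference of two gaps is
  continuous and never an integer. Lying strictly between 0 and 1 at one point of \<open>D\<close>,
  it does so on all of \<open>D\<close>, which keeps \<open>D\<close> inside the cell.\<close>

lemma open_cell_in_components:
  assumes u: "u permutes {1..m}"
  shows "open_cell m u \<in> components (generic_points m)"
  unfolding in_components_maximal
proof (intro conjI allI impI)
  show "open_cell m u \<noteq> {}" by (rule open_cell_nonempty[OF u])
  show "open_cell m u \<subseteq> generic_points m" by (rule open_cell_subset_generic_points[OF u])
  show "connected (open_cell m u)" by (rule connected_open_cell)
  fix D assume D: "D \<noteq> {} \<and> open_cell m u \<subseteq> D \<and> D \<subseteq> generic_points m \<and> connected D"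
  obtain x where x: "x \<in> open_cell m u"
    using open_cell_nonempty[OF u] by blast
  have "D \<subseteq> open_cell m u"
  proof
    fix y assume y: "y \<in> D"
    have "gap u y i < gap u y j \<and> gap u y j < gap u y i + 1" if ij: "i \<le> m" "j \<le> m" "u i < u j" for i j
    proof -
      define d where "d z = gap u z j - gap u z i" for z
      have "continuous_on D d"
        unfolding d_def gap_def by (intro continuous_intros continuous_z_coord)
      then have conn: "connected (d ` D)"
        using D by (intro connected_continuous_image) auto
      have "i \<noteq> j" using ij by auto
      then have "d z \<notin> \<int>" if "z \<in> D" for z
        using generic_points_neqD[of z m j i] D that ij by (auto simp: d_def gap_diff_in_Ints_iff)
      then have avoid: "0 \<notin> d ` D" "1 \<notin> d ` D"
        by (metis (no_types, lifting) Ints_0 Ints_1 imageE)+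
      have mem: "d x \<in> d ` D" "d y \<in> d ` D"
        using x y D by auto
      have dx: "0 < d x" "d x < 1"
        using x ij by (auto simp: open_cell_def d_def) force
      have "0 < d y"
        using connectedD_interval[OF conn mem(2,1), of 0] avoid dx by force
      moreover have "d y < 1"
        using connectedD_interval[OF conn mem, of 1] avoid dx by force
      ultimately show ?thesis by (simp add: d_def)
    qed
    moreover have "y \<in> coord_space m"
      using y D by (auto simp: generic_points_def)
    ultimately show "y \<in> open_cell m u"
      by (simp add: open_cell_def)
  qed
  then show "D = open_cell m u" using D by blast
qed

text \<open>The parameter is the rank permutation, the inverse of Stanley's \<open>w\<close>, so the
  descent condition falls on \<open>u\<close> itself.\<close>

definition cell_perms :: "nat \<Rightarrow> nat \<Rightarrow> (nat \<Rightarrow> nat) set" where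
  "cell_perms k m = {u. u permutes {1..m} \<and> Suc (des u m) = k}"

lemma alcoves_eq: "alcoves m = closure ` components (generic_points m)"
  unfolding alcoves_def alcove_complement_eq ..

text \<open>Any point of a component whose closure lies in the hypersimplex belongs to some open
  cell. That cell is a component too, and components that meet coincide.\<close>

lemma alcove_simplices_eq:
  assumes "1 \<le> m" "0 < k"
  shows "alcove_simplices k (Suc m) = closed_cell m ` cell_perms k m"
proof (intro equalityI subsetI)
  fix A assume "A \<in> alcove_simplices k (Suc m)"
  then obtain C where C: "C \<in> components (generic_points m)" "A = closure C"
      "A \<subseteq> proj_hypersimplex k (Suc m)"
    by (auto simp: alcove_simplices_def alcoves_eq)
  obtain x where x: "x \<in> C"
    using C(1) in_components_nonempty by blast
  have "x \<in> generic_points m"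
    using C(1) x in_components_subset by blast
  moreover have "x \<in> proj_hypersimplex k (Suc m)"
    using x C closure_subset by blast
  ultimately obtain u where u: "u permutes {1..m}" "Suc (des u m) = k" "x \<in> open_cell m u"
    using exists_open_cell assms by blast
  then have "C = open_cell m u"
    using components_eq[OF C(1) open_cell_in_components[OF u(1)]] x by blast
  then show "A \<in> closed_cell m ` cell_perms k m"
    using u C(2) by (auto simp: cell_perms_def closure_open_cell)
next
  fix A assume "A \<in> closed_cell m ` cell_perms k m"
  then obtain u where u: "u permutes {1..m}" "Suc (des u m) = k" "A = closed_cell m u"
    by (auto simp: cell_perms_def)
  then show "A \<in> alcove_simplices k (Suc m)"
    using open_cell_in_components[OF u(1)] closure_open_cell[OF u(1)]
      closed_cell_subset_proj_hypersimplex[OF u(1)]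
    by (auto simp: alcove_simplices_def alcoves_eq)
qed

lemma stanley_simplices_eq:
  assumes "1 \<le> m" "0 < k"
  shows "stanley_simplices k (Suc m) = closed_cell m ` cell_perms k m"
proof -
  have reg: "closure {x \<in> unit_cube m. stanley_map m x \<in> perm_region m w} = closed_cell m (inv w)"
    if "w permutes {1..m}" for w
    unfolding stanley_region_eq_open_cell[OF that assms(1)] by (rule closure_open_cell[OF permutes_inv[OF that]])
  have des: "card (descents m u) = k - 1 \<longleftrightarrow> Suc (des u m) = k" if "u permutes {1..m}" for u
    using card_descents[of u m, OF permutes_zero[OF that]] assms(2) by auto
  show ?thesis
  proof (intro equalityI subsetI)
    fix A assume "A \<in> stanley_simplices k (Suc m)"
    then obtain w where w: "w permutes {1..m}" "card (descents m (inv w)) = k - 1"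
        "A = closure {x \<in> unit_cube m. stanley_map m x \<in> perm_region m w}"
      by (auto simp: stanley_simplices_def)
    then show "A \<in> closed_cell m ` cell_perms k m"
      using des[OF permutes_inv[OF w(1)]] reg[OF w(1)] permutes_inv[OF w(1)]
      by (auto simp: cell_perms_def)
  next
    fix A assume "A \<in> closed_cell m ` cell_perms k m"
    then obtain u where u: "u permutes {1..m}" "Suc (des u m) = k" "A = closed_cell m u"
      by (auto simp: cell_perms_def)
    then have "inv u permutes {1..m}" "card (descents m (inv (inv u))) = k - 1"
        "A = closure {x \<in> unit_cube m. stanley_map m x \<in> perm_region m (inv u)}"
      using des[OF u(1)] reg[OF permutes_inv[OF u(1)]]
      by (simp_all add: permutes_inv permutes_inv_inv)
    then show "A \<in> stanley_simplices k (Suc m)"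
      unfolding stanley_simplices_def by auto
  qed
qed

section \<open>Covering the projected hypersimplex by closed cells\<close>

lemma exists_generic_point:
  assumes "1 \<le> m" "0 < k" "k \<le> m"
  obtains q where "q \<in> proj_hypersimplex k (Suc m)" "q \<in> generic_points m"
proof -
  \<comment> \<open>All coordinates of the point will equal an irrational \<open>a\<close>:
    differences of partial sums are then nonzero integer multiples of \<open>a\<close>, and the
    bounds on \<open>a\<close> put \<open>a * m\<close> strictly between \<open>k - 1\<close> and
    \<open>k\<close>.\<close>
  have "uncountable ({(real k - 1) / real m<..<real k / real m} - \<rat>)"
    using assms by (intro uncountable_minus_countable countable_rat)
      (simp add: uncountable_open_interval divide_strict_right_mono)
  then obtain a where a: "(real k - 1) / real m < a" "a < real k / real m" "a \<notin> \<rat>"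
    by (metis Diff_iff countable_empty ex_in_conv greaterThanLessThan_iff)
  define q where "q = of_z m (\<lambda>i. a * real i)"
  have z: "z_coord q i = a * real i" if "i \<le> m" for i
    using z_coord_of_z[of "\<lambda>i. a * real i" i m] that by (simp add: q_def)
  have am: "real k - 1 < a * real m" "a * real m < real k"
    using a assms by (simp_all add: field_simps)
  have "0 \<le> (real k - 1) / real m" "real k / real m \<le> 1"
    using assms by simp_all
  then have a01: "0 < a" "a < 1"
    using a by linarith+
  have "q \<in> unit_cube m"
  proof (rule unit_cubeI)
    show "q \<in> coord_space m" by (simp add: q_def of_z_mem)
    show "0 \<le> q (Suc i) \<and> q (Suc i) \<le> 1" if "Suc i \<le> m" for i
      using that a01 by (simp add: q_def of_z_def algebra_simps)
  qed
  then have "q \<in> proj_hypersimplex k (Suc m)"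
    using am z[of m] by (simp add: proj_hypersimplex_iff)
  moreover have "q \<in> generic_points m"
    unfolding generic_points_def
  proof (intro CollectI conjI allI impI)
    show "q \<in> coord_space m" by (simp add: q_def of_z_mem)
    fix i j assume ij: "i < j \<and> j \<le> m"
    show "z_coord q i - z_coord q j \<notin> \<int>"
    proof
      assume "z_coord q i - z_coord q j \<in> \<int>"
      then have "a * (real i - real j) \<in> \<int>"
        using ij by (simp add: z right_diff_distrib)
      then obtain l where "a * (real i - real j) = of_int l"
        by (auto elim: Ints_cases)
      then have "a = of_int l / (real i - real j)"
        using ij by (simp add: field_simps)
      then show False using a(3) by simp
    qed
  qed
  ultimately show ?thesis using that by blast
qed

text \<open>The segment ends at the generic point \<open>q\<close>, which lies on none of the
  countably many hyperplanes, so it meets each of them at most once.\<close>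

lemma countable_nongeneric_times:
  assumes x: "x \<in> coord_space m" and q: "q \<in> generic_points m"
  shows "countable {t. (1 - t) *\<^sub>R x + t *\<^sub>R q \<notin> generic_points m}"
proof -
  define T where "T i j l = {t. (1 - t) * (z_coord x i - z_coord x j) + t * (z_coord q i - z_coord q j) =
      real_of_int l}" for i j l
  have "countable (T i j l)" if ij: "i < j" "j \<le> m" for i j l
  proof -
    define a b where "a = z_coord x i - z_coord x j" and "b = z_coord q i - z_coord q j"
    have b: "b \<notin> \<int>" using q ij by (simp add: generic_points_def b_def)
    have "T i j l \<subseteq> {(real_of_int l - a) / (b - a)}"
    proof
      fix t assume "t \<in> T i j l"
      then have eq: "(1 - t) * a + t * b = real_of_int l" by (simp add: T_def a_def b_def)
      have "a \<noteq> b"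
      proof
        assume "a = b"
        then have "b = real_of_int l" using eq by (simp add: algebra_simps)
        then show False using b by simp
      qed
      then show "t \<in> {(real_of_int l - a) / (b - a)}"
        using eq by (simp add: field_simps)
    qed
    then show ?thesis by (rule countable_subset) simp
  qed
  then have "countable (\<Union>j\<in>{..m}. \<Union>i\<in>{..<j}. \<Union>l. T i j l)"
    by (intro countable_UN) auto
  moreover have "{t. (1 - t) *\<^sub>R x + t *\<^sub>R q \<notin> generic_points m} \<subseteq> (\<Union>j\<in>{..m}. \<Union>i\<in>{..<j}. \<Union>l. T i j l)"
  proof
    fix t assume "t \<in> {t. (1 - t) *\<^sub>R x + t *\<^sub>R q \<notin> generic_points m}"
    moreover have "(1 - t) *\<^sub>R x + t *\<^sub>R q \<in> coord_space m"
      using x q by (intro subspace_add subspace_scale subspace_coord_space) (auto simp: generic_points_def)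
    ultimately obtain i j where ij: "i < j" "j \<le> m"
        "z_coord ((1 - t) *\<^sub>R x + t *\<^sub>R q) i - z_coord ((1 - t) *\<^sub>R x + t *\<^sub>R q) j \<in> \<int>"
      by (auto simp: generic_points_def)
    then obtain l where "z_coord ((1 - t) *\<^sub>R x + t *\<^sub>R q) i - z_coord ((1 - t) *\<^sub>R x + t *\<^sub>R q) j = of_int l"
      by (auto elim: Ints_cases)
    then have "t \<in> T i j l"
      unfolding T_def z_coord_add z_coord_scaleR by (simp add: algebra_simps)
    then show "t \<in> (\<Union>j\<in>{..m}. \<Union>i\<in>{..<j}. \<Union>l. T i j l)"
      using ij by auto
  qed
  ultimately show ?thesis by (rule countable_subset[rotated])
qed

text \<open>The union \<open>S\<close> of the cells is closed because there are finitely many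
  permutations. On the segment from \<open>x\<close> to a generic point all but countably many times
  give points of open cells, and \<open>x\<close> is a limit of these.\<close>

lemma closed_cells_cover:
  assumes x: "x \<in> proj_hypersimplex k (Suc m)" and km: "1 \<le> m" "0 < k" "k \<le> m"
  obtains u where "u \<in> cell_perms k m" "x \<in> closed_cell m u"
proof -
  obtain q where q: "q \<in> proj_hypersimplex k (Suc m)" "q \<in> generic_points m"
    using exists_generic_point[OF km] .
  define f where "f t = (1 - t) *\<^sub>R x + t *\<^sub>R q" for t
  define B where "B = {t. f t \<notin> generic_points m}"
  define S where "S = \<Union>(closed_cell m ` cell_perms k m)"
  have "finite (cell_perms k m)"
    by (rule finite_subset[OF _ finite_permutations[of "{1..m}"]]) (auto simp: cell_perms_def)
  then have "closed S"
    unfolding S_def by (intro closed_Union) (auto simp: closed_closed_cell)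
  have "x \<in> coord_space m"
    using x by (auto simp: proj_hypersimplex_iff unit_cube_def)
  then have B: "countable B"
    unfolding B_def f_def using countable_nongeneric_times q by blast
  have "f t \<in> S" if t: "t \<in> {0<..<1} - B" for t
  proof -
    have "f t \<in> proj_hypersimplex k (Suc m)"
      unfolding f_def using convexD[OF convex_proj_hypersimplex x q(1), of "1 - t" t] t by auto
    moreover have "f t \<in> generic_points m"
      using t by (auto simp: B_def)
    ultimately obtain u where "u permutes {1..m}" "Suc (des u m) = k" "f t \<in> open_cell m u"
      using exists_open_cell[OF _ _ km(1,2)] by blast
    then show ?thesis
      using open_cell_subset_closed_cell by (auto simp: S_def cell_perms_def)
  qed
  then have "f ` closure ({0<..<1} - B) \<subseteq> S"
    by (intro image_closure_subset \<open>closed S\<close>) (auto simp: f_def intro!: continuous_segment_fun)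
  moreover have "0 \<in> closure ({0<..<1} - B)"
    unfolding closure_approachable
  proof (intro allI impI)
    fix e :: real assume e: "0 < e"
    have "uncountable ({0<..<min e 1} - B)"
      using e B by (intro uncountable_minus_countable) (simp_all add: uncountable_open_interval)
    then obtain t where "t \<in> {0<..<min e 1} - B"
      by (metis countable_empty ex_in_conv)
    then show "\<exists>t\<in>{0<..<1} - B. dist t 0 < e"
      by (intro bexI[of _ t]) (auto simp: dist_real_def)
  qed
  ultimately have "f 0 \<in> S" by blast
  then show ?thesis
    using that by (auto simp: S_def f_def)
qed

subsection \<open>Sorted collections as vertex sets of cells\<close>

lemma cell_permsD:
  assumes "u \<in> cell_perms k m"
  shows "u permutes {1..m}" "Suc (des u m) = k"
  using assms by (auto simp: cell_perms_def)

lemma drop_eps_mem_proj_hypersimplex: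
  assumes I: "I \<in> k_subsets k (Suc m)"
  shows "drop_last_coord (Suc m) (eps I) \<in> proj_hypersimplex k (Suc m)"
  unfolding proj_hypersimplex_iff
proof (intro conjI unit_cubeI drop_last_coord_mem)
  have "card_upto I (Suc m) = k" by (simp add: card_upto_top[OF I])
  then have "k \<le> card_upto I m + 1" "card_upto I m \<le> k"
    using card_upto_Suc[OF finite_k_subset[OF I], of m] by (auto split: if_splits)
  then show "real k - 1 \<le> z_coord (drop_last_coord (Suc m) (eps I)) m"
    "z_coord (drop_last_coord (Suc m) (eps I)) m \<le> real k"
    by (simp_all add: z_coord_drop_last_coord z_coord_eps[OF I])
qed (auto simp: drop_last_coord_def eps_def indicator_def)

text \<open>This is the shape in which the Sturmfels and circuit simplices are defined.\<close>

lemma closed_cell_eq_image_hull: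
  assumes "u permutes {1..m}"
  shows "closed_cell m u =
    drop_last_coord (Suc m) ` (convex hull (eps ` cell_set (Suc m) u ` {..m}))"
  unfolding closed_cell_eq_hull[OF assms] convex_hull_linear_image[OF linear_drop_last_coord]
  by (simp add: image_image cell_vertex_def[abs_def])

text \<open>On the hypersimplex all coordinates sum to \<open>k\<close>, so the dropped one can be
  recovered. Surjectivity comes from the covering by cells, each of which is the image of a hull of
  points \<open>eps I\<close>.\<close>

lemma bij_betw_drop_last_coord:
  assumes km: "1 \<le> m" "0 < k" "k \<le> m"
  shows "bij_betw (drop_last_coord (Suc m)) (hypersimplex k (Suc m)) (proj_hypersimplex k (Suc m))"
  unfolding bij_betw_def
proof
  let ?A = "{x \<in> coord_space (Suc m). z_coord x (Suc m) = real k}"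
  have "convex ?A"
  proof (rule convexI)
    fix x y and a b :: real
    assume "x \<in> ?A" "y \<in> ?A" "0 \<le> a" "0 \<le> b" "a + b = 1"
    then show "a *\<^sub>R x + b *\<^sub>R y \<in> ?A"
      by (auto simp: z_coord_add z_coord_scaleR simp flip: distrib_right
          intro!: subspace_add subspace_scale subspace_coord_space)
  qed
  moreover have "eps ` k_subsets k (Suc m) \<subseteq> ?A"
    by (auto simp: z_coord_eps card_upto_top) (auto simp: coord_space_def k_subsets_def eps_def indicator_def)
  ultimately have sub: "hypersimplex k (Suc m) \<subseteq> ?A"
    unfolding hypersimplex_def by (intro hull_minimal)
  show "inj_on (drop_last_coord (Suc m)) (hypersimplex k (Suc m))"
  proof (rule inj_onI)
    fix x y assume xy: "x \<in> hypersimplex k (Suc m)" "y \<in> hypersimplex k (Suc m)"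
      and eq: "drop_last_coord (Suc m) x = drop_last_coord (Suc m) y"
    show "x = y"
    proof (rule coord_space_eqI)
      show "x \<in> coord_space (Suc m)" "y \<in> coord_space (Suc m)" using sub xy by auto
      fix i assume "i \<le> Suc m"
      then consider "i = Suc m" | "i \<le> m" by linarith
      then show "z_coord x i = z_coord y i"
      proof cases
        case 1
        have "z_coord x (Suc m) = real k" "z_coord y (Suc m) = real k"
          using sub xy by auto
        then show ?thesis using 1 by simp
      next
        case 2
        then show ?thesis by (metis eq z_coord_drop_last_coord)
      qed
    qed
  qed
  show "drop_last_coord (Suc m) ` hypersimplex k (Suc m) = proj_hypersimplex k (Suc m)"
  proof
    show "drop_last_coord (Suc m) ` hypersimplex k (Suc m) \<subseteq> proj_hypersimplex k (Suc m)"
      unfolding hypersimplex_def convex_hull_linear_image[OF linear_drop_last_coord]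
      by (intro hull_minimal convex_proj_hypersimplex) (auto simp: drop_eps_mem_proj_hypersimplex)
    show "proj_hypersimplex k (Suc m) \<subseteq> drop_last_coord (Suc m) ` hypersimplex k (Suc m)"
    proof
      fix x assume "x \<in> proj_hypersimplex k (Suc m)"
      then obtain u where u: "u \<in> cell_perms k m" "x \<in> closed_cell m u"
        using closed_cells_cover km by blast
      note p = cell_permsD[OF u(1)]
      have "eps ` cell_set (Suc m) u ` {..m} \<subseteq> eps ` k_subsets k (Suc m)"
        using cell_set_mem[OF p(1)] p(2) by auto
      then have "convex hull (eps ` cell_set (Suc m) u ` {..m}) \<subseteq> hypersimplex k (Suc m)"
        unfolding hypersimplex_def by (rule hull_mono)
      then show "x \<in> drop_last_coord (Suc m) ` hypersimplex k (Suc m)"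
        using u(2) unfolding closed_cell_eq_image_hull[OF p(1)] by blast
    qed
  qed
qed

lemma inj_on_cell_set:
  assumes "u permutes {1..m}"
  shows "inj_on (cell_set (Suc m) u) {..m}"
  using inj_on_cell_vertex[OF assms] by (auto simp: inj_on_def cell_vertex_def)

text \<open>As \<open>s\<close> grows, the indicator in \<open>zvert u s i\<close> can only change
  from 1 to 0, so the counting functions interlace.\<close>

lemma sorted_collection_cell_sets:
  assumes u: "u \<in> cell_perms k m"
  shows "sorted_collection k (Suc m) (map (cell_set (Suc m) u) [0..<Suc m])"
proof -
  note p = cell_permsD[OF u]
  have mem: "cell_set (Suc m) u s \<in> k_subsets k (Suc m)" if "s \<le> m" for s
    using cell_set_mem[OF p(1) that] p(2) by simp
  have "sorted_pair (cell_set (Suc m) u s) (cell_set (Suc m) u t)" if st: "s < t" "t \<le> m" for s t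
  proof -
    have s: "s \<le> m" using st by simp
    have "card_upto (cell_set (Suc m) u t) i \<le> card_upto (cell_set (Suc m) u s) i \<and>
      card_upto (cell_set (Suc m) u s) i \<le> card_upto (cell_set (Suc m) u t) i + 1" for i
    proof (cases "i \<le> Suc m")
      case True
      then show ?thesis
        using st by (auto simp: card_upto_cell_set permutes_zero[OF p(1)] zvert_def)
    next
      case False
      then show ?thesis
        by (simp add: card_upto_top[OF mem[OF s]] card_upto_top[OF mem[OF st(2)]])
    qed
    then show ?thesis
      using sorted_pair_iff[OF mem[OF s] mem[OF st(2)]] by blast
  qed
  moreover have "distinct (map (cell_set (Suc m) u) [0..<Suc m])"
    using inj_on_cell_set[OF p(1)]
    by (simp add: distinct_map atLeast0LessThan lessThan_Suc_atMost del: upt_Suc)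
  ultimately show ?thesis
    unfolding sorted_collection_def using mem by (auto simp del: upt_Suc simp: nth_append)
qed

text \<open>One value below \<open>b\<close> would force all others to be at most \<open>b\<close>,
  and the average would fall below \<open>b\<close>; the upper bound is symmetric. This carries the
  inequalities of a cell from a barycentre to the points averaged.\<close>

lemma int_average_bounds:
  fixes v :: "nat \<Rightarrow> int"
  assumes close: "\<And>s t. s < r \<Longrightarrow> t < r \<Longrightarrow> v s \<le> v t + 1"
    and sum: "b * int r \<le> (\<Sum>s<r. v s)" "(\<Sum>s<r. v s) \<le> (b + 1) * int r"
    and s: "s < r"
  shows "b \<le> v s \<and> v s \<le> b + 1"
proof (rule ccontr)
  assume "\<not> (b \<le> v s \<and> v s \<le> b + 1)"
  then consider "v s < b" | "b + 1 < v s" by linarith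
  then show False
  proof cases
    case 1
    then have "v t \<le> b" if "t < r" for t
      using close[OF that s] by linarith
    then have "(\<Sum>t<r. v t) < (\<Sum>t<r. b)"
      using 1 s by (intro sum_strict_mono_ex1) auto
    then show False using sum(1) by (simp add: mult.commute)
  next
    case 2
    then have "b + 1 \<le> v t" if "t < r" for t
      using close[OF s that] by linarith
    then have "(\<Sum>t<r. b + 1) < (\<Sum>t<r. v t)"
      using 2 s by (intro sum_strict_mono_ex1) auto
    then show False using sum(2) by (simp add: mult.commute)
  qed
qed

text \<open>A closed cell containing the barycentre \<open>x\<close> contains every member, by
  \<open>key\<close>. An integral point of a cell has all gaps 0 or 1, with the ones at the highest
  ranks, so it is a vertex.\<close>

lemma sorted_collection_cell:
  assumes Is: "sorted_collection k (Suc m) Is" and km: "1 \<le> m" "0 < k" "k \<le> m"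
  obtains u where "u \<in> cell_perms k m" "set Is \<subseteq> cell_set (Suc m) u ` {..m}"
proof (cases "Is = []")
  \<comment> \<open>There is no barycentre of an empty collection, but any cell will do.\<close>
  case True
  then show ?thesis
    using that exists_generic_point[OF km] closed_cells_cover[OF _ km] by (metis empty_set empty_subsetI)
next
  case False
  define r where "r = length Is"
  have r: "0 < r" using False by (simp add: r_def)
  have mem: "Is ! s \<in> k_subsets k (Suc m)" if "s < r" for s
    using Is that by (auto simp: sorted_collection_def r_def)
  define F where "F s i = int (card_upto (Is ! s) i)" for s i
  have pair: "F t i \<le> F s i \<and> F s i \<le> F t i + 1" if "s < t" "t < r" for s t i
  proof -
    have "sorted_pair (Is ! s) (Is ! t)"
      using Is that by (simp add: sorted_collection_def r_def)
    then have "card_upto (Is ! t) i \<le> card_upto (Is ! s) i"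
      "card_upto (Is ! s) i \<le> card_upto (Is ! t) i + 1"
      using sorted_pair_iff[OF mem mem, of s t] that by auto
    then show ?thesis unfolding F_def by linarith
  qed
  define P where "P s = drop_last_coord (Suc m) (eps (Is ! s))" for s
  define x where "x = (\<Sum>s<r. (1 / real r) *\<^sub>R P s)"
  have zP: "z_coord (P s) i = real_of_int (F s i)" if "s < r" "i \<le> m" for s i
    using that by (simp add: P_def z_coord_drop_last_coord z_coord_eps[OF mem] F_def)
  have zx: "z_coord x i = real_of_int (\<Sum>s<r. F s i) / real r" if "i \<le> m" for i
    using that by (simp add: x_def z_coord_sum z_coord_scaleR zP sum_divide_distrib)
  have "x \<in> proj_hypersimplex k (Suc m)"
    unfolding x_def using r
    by (intro convex_sum convex_proj_hypersimplex)
      (auto simp: P_def intro!: drop_eps_mem_proj_hypersimplex mem)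
  then obtain u where u: "u \<in> cell_perms k m" "x \<in> closed_cell m u"
    using closed_cells_cover km by blast
  note p = cell_permsD[OF u(1)]
  have key: "int (des u j) - int (des u i) \<le> F s j - F s i \<and>
      F s j - F s i \<le> int (des u j) - int (des u i) + 1"
    if ij: "i \<le> m" "j \<le> m" "u i < u j" and s: "s < r" for i j s
  proof (rule int_average_bounds[OF _ _ _ s])
    fix s t assume st: "s < r" "t < r"
    \<comment> \<open>Two members differ by 0 or 1 at \<open>i\<close> and at \<open>j\<close>, with
      the same sign, so the two differences are at most 1 apart.\<close>
    then show "F s j - F s i \<le> F t j - F t i + 1"
      using pair[of s t i] pair[of s t j] pair[of t s i] pair[of t s j]
      by (cases s t rule: linorder_cases) auto
  next
    define S where "S = (\<Sum>s<r. F s j - F s i)"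
    have "gap u x i \<le> gap u x j" "gap u x j \<le> gap u x i + 1"
      using u(2) ij by (auto simp: closed_cell_def)
    moreover have "z_coord x j - z_coord x i = real_of_int S / real r"
      using ij by (simp add: zx S_def sum_subtractf diff_divide_distrib)
    ultimately have "real (des u j) - real (des u i) \<le> real_of_int S / real r"
      "real_of_int S / real r \<le> real (des u j) - real (des u i) + 1"
      by (simp_all add: gap_def)
    then have "(real (des u j) - real (des u i)) * real r \<le> real_of_int S"
      "real_of_int S \<le> (real (des u j) - real (des u i) + 1) * real r"
      using r by (simp_all add: pos_le_divide_eq pos_divide_le_eq)
    then have "real_of_int ((int (des u j) - int (des u i)) * int r) \<le> real_of_int S"
      "real_of_int S \<le> real_of_int ((int (des u j) - int (des u i) + 1) * int r)"
      by simp_all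
    then show "(int (des u j) - int (des u i)) * int r \<le> (\<Sum>s<r. F s j - F s i)"
      "(\<Sum>s<r. F s j - F s i) \<le> (int (des u j) - int (des u i) + 1) * int r"
      unfolding S_def by linarith+
  qed
  have "Is ! s \<in> cell_set (Suc m) u ` {..m}" if s: "s < r" for s
  proof -
    define h where "h i = F s i - int (des u i)" for i
    have h0: "h 0 = 0"
      by (simp add: h_def F_def card_upto_0[OF mem[OF s]])
    have h: "h i \<le> h j \<and> h j \<le> h i + 1" if "i \<le> m" "j \<le> m" "u i < u j" for i j
      using key[OF that s] by (simp add: h_def)
    have h01: "h i = 0 \<or> h i = 1" if "i \<le> m" for i
    proof (cases "i = 0")
      case False
      then show ?thesis
        using h[of 0 i] permutes_zero_less[OF p(1), of i] h0 that by auto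
    qed (simp add: h0)
    \<comment> \<open>\<open>M\<close> holds the ranks of the indices with gap 0, among them the
      rank of index 0. Its maximum is the threshold beyond which all gaps are 1, and so the number
      of the vertex.\<close>
    define M where "M = u ` {i. i \<le> m \<and> h i = 0}"
    have M: "finite M" "M \<noteq> {}"
      using h0 by (auto simp: M_def)
    obtain l where l: "l \<le> m" "h l = 0" "u l = Max M"
      using Max_in[OF M] by (auto simp: M_def)
    have le: "Max M \<le> m"
      using l permutes_le_iff[OF p(1), of l] by simp
    have hl: "h i = (if Max M < u i then 1 else 0)" if i: "i \<le> m" for i
    proof (cases "Max M < u i")
      case True
      then have "u i \<notin> M" using Max_ge[OF M(1)] by (meson not_less)
      then show ?thesis using True h01[OF i] i by (auto simp: M_def)
    next
      case False
      then consider "u i = u l" | "u i < u l" using l(3) by linarith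
      then have "h i \<le> 0"
      proof cases
        case 1
        then have "i = l" by (simp only: permutes_eq_iff[OF p(1)])
        then show ?thesis using l by simp
      next
        case 2
        then show ?thesis using h[OF i l(1)] l by simp
      qed
      then show ?thesis using False h01[OF i] by auto
    qed
    have "Is ! s = cell_set (Suc m) u (Max M)"
    proof (rule k_subset_eqI[OF mem[OF s]])
      show "cell_set (Suc m) u (Max M) \<in> k_subsets k (Suc m)"
        using cell_set_mem[OF p(1) le] p(2) by simp
      fix i assume "i < Suc m"
      then have i: "i \<le> m" by simp
      have "int (card_upto (Is ! s) i) = int (des u i) + (if Max M < u i then 1 else 0)"
        using hl[OF i] by (simp add: h_def F_def)
      then show "card_upto (Is ! s) i = card_upto (cell_set (Suc m) u (Max M)) i"
        using i by (simp add: card_upto_cell_set permutes_zero[OF p(1)] zvert_def split: if_splits)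
    qed
    then show ?thesis using le by blast
  qed
  then have "set Is \<subseteq> cell_set (Suc m) u ` {..m}"
    by (auto simp: in_set_conv_nth r_def)
  then show ?thesis using that u(1) by blast
qed

lemma set_map_upto: "set (map f [0..<Suc m]) = f ` {..m}"
  by (auto simp del: upt_Suc)

lemma maximal_sorted_collection_cell_sets:
  assumes "u \<in> cell_perms k m"
  shows "maximal_sorted_collection k (Suc m) (map (cell_set (Suc m) u) [0..<Suc m])"
  by (rule sorted_collection_maximalI[OF sorted_collection_cell_sets[OF assms]]) auto

text \<open>A maximal collection lies among the sets of one cell, which themselves form a sorted
  collection, so it has to exhaust them.\<close>

lemma sturmfels_simplices_eq:
  assumes km: "1 \<le> m" "0 < k" "k \<le> m"
  shows "sturmfels_simplices k (Suc m) = closed_cell m ` cell_perms k m"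
proof (intro equalityI subsetI)
  fix A assume "A \<in> sturmfels_simplices k (Suc m)"
  then obtain Is where Is: "maximal_sorted_collection k (Suc m) Is"
      "A = drop_last_coord (Suc m) ` (convex hull (eps ` set Is))"
    by (auto simp: sturmfels_simplices_def)
  have "sorted_collection k (Suc m) Is"
    using Is(1) by (simp add: maximal_sorted_collection_def)
  then obtain u where u: "u \<in> cell_perms k m" "set Is \<subseteq> cell_set (Suc m) u ` {..m}"
    using sorted_collection_cell km by blast
  have "set Is = cell_set (Suc m) u ` {..m}"
    using Is(1) u(2) sorted_collection_cell_sets[OF u(1)]
    unfolding maximal_sorted_collection_def by (metis psubsetI set_map_upto)
  then show "A \<in> closed_cell m ` cell_perms k m"
    using Is(2) u(1) closed_cell_eq_image_hull[OF cell_permsD(1)[OF u(1)]] by (metis image_eqI)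
next
  fix A assume "A \<in> closed_cell m ` cell_perms k m"
  then obtain u where u: "u \<in> cell_perms k m" "A = closed_cell m u" by blast
  then have "A = drop_last_coord (Suc m) ` (convex hull (eps ` set (map (cell_set (Suc m) u) [0..<Suc m])))"
    unfolding set_map_upto using closed_cell_eq_image_hull[OF cell_permsD(1)[OF u(1)]] by simp
  then show "A \<in> sturmfels_simplices k (Suc m)"
    unfolding sturmfels_simplices_def using maximal_sorted_collection_cell_sets[OF u(1)] by blast
qed

subsection \<open>Circuits\<close>

lemma circuit_graph_simps [simp]:
  "tail (circuit_graph k n) a = fst a" "head (circuit_graph k n) a = snd (snd a)"
  "verts (circuit_graph k n) = eps ` k_subsets k n"
  by (simp_all add: circuit_graph_def split_beta)

lemma circuit_arc_iff:
  "(e, i, e') \<in> arcs (circuit_graph k n) \<longleftrightarrow>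
    e \<in> eps ` k_subsets k n \<and> i \<in> {1..n} \<and> e i = 1 \<and> e (cyc_succ n i) = 0 \<and>
    e' = e(i := 0, cyc_succ n i := 1)"
  by (auto simp: circuit_graph_def)

lemma circuit_arcI:
  assumes "I \<in> k_subsets k n" "i \<in> I" "cyc_succ n i \<notin> I" "J = insert (cyc_succ n i) (I - {i})"
  shows "(eps I, i, eps J) \<in> arcs (circuit_graph k n)"
  unfolding circuit_arc_iff
proof (intro conjI)
  show "i \<in> {1..n}" using assms by (auto simp: k_subsets_def)
  show "eps J = (eps I)(i := 0, cyc_succ n i := 1)"
    using assms by (auto simp: eps_def indicator_def fun_eq_iff)
qed (use assms in \<open>auto simp: eps_def\<close>)

lemma z_coord_upd:
  "z_coord (x(p := a)) j = z_coord x j + (if 1 \<le> p \<and> p \<le> j then a - x p else 0)"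
proof (induction j)
  case (Suc j)
  then show ?case by (auto simp: z_coord_Suc le_Suc_eq)
qed simp

text \<open>With label \<open>Suc m\<close> the moved 1 reappears at position 1 and enters every
  partial sum up to \<open>m\<close>. With a smaller label \<open>i\<close> it is missing only from
  the sum that stops at \<open>i\<close>.\<close>

lemma circuit_arc_z_coord:
  assumes a: "(e, i, e') \<in> arcs (circuit_graph k (Suc m))" and j: "j \<in> {1..m}"
  shows "z_coord e' j = z_coord e j - of_bool (i = j) + of_bool (i = Suc m)"
proof -
  have i: "i \<in> {1..Suc m}" "e i = 1" "e (cyc_succ (Suc m) i) = 0"
      "e' = e(i := 0, cyc_succ (Suc m) i := 1)"
    using a by (auto simp: circuit_arc_iff)
  show ?thesis
  proof (cases "i = Suc m")
    case True
    then show ?thesis using i j by (auto simp: z_coord_upd cyc_succ_def)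
  next
    case False
    then show ?thesis using i j by (auto simp: z_coord_upd cyc_succ_def)
  qed
qed

definition labels :: "labelled_arc list \<Rightarrow> nat list" where
  "labels p = map (\<lambda>a. fst (snd a)) p"

lemma circuit_walk_z_coord:
  assumes "pre_digraph.cas (circuit_graph k (Suc m)) e p e'"
    and "set p \<subseteq> arcs (circuit_graph k (Suc m))" and j: "j \<in> {1..m}"
  shows "z_coord e' j =
    z_coord e j - real (count_list (labels p) j) + real (count_list (labels p) (Suc m))"
  using assms(1,2)
proof (induction p arbitrary: e)
  case Nil
  then show ?case by (simp add: pre_digraph.cas.simps labels_def)
next
  case (Cons a p)
  obtain e0 i e1 where a: "a = (e0, i, e1)" by (cases a)
  have "e0 = e" "pre_digraph.cas (circuit_graph k (Suc m)) e1 p e'"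
    using Cons.prems(1) by (simp_all add: pre_digraph.cas.simps a)
  moreover have "(e0, i, e1) \<in> arcs (circuit_graph k (Suc m))"
    using Cons.prems(2) a by simp
  ultimately show ?case
    using Cons.IH[of e1] Cons.prems(2) circuit_arc_z_coord[OF _ j, of e0 i e1 k]
    by (auto simp: labels_def a)
qed

lemma cas_append:
  "pre_digraph.cas G u (p @ q) v \<longleftrightarrow> (\<exists>x. pre_digraph.cas G u p x \<and> pre_digraph.cas G x q v)"
  by (induction p arbitrary: u) (auto simp: pre_digraph.cas.simps)

text \<open>The reason is that every partial sum returns to its initial value along a closed walk.\<close>

lemma closed_walk_count_labels:
  assumes "pre_digraph.cas (circuit_graph k (Suc m)) e c e"
    and "set c \<subseteq> arcs (circuit_graph k (Suc m))"
  shows "j \<in> {1..Suc m} \<Longrightarrow> count_list (labels c) j = count_list (labels c) (Suc m)"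
    and "length c = Suc m * count_list (labels c) (Suc m)"
proof -
  have eq: "count_list (labels c) j = count_list (labels c) (Suc m)" if "j \<in> {1..Suc m}" for j
  proof (cases "j = Suc m")
    case False
    then have "j \<in> {1..m}" using that by auto
    from circuit_walk_z_coord[OF assms this] show ?thesis by simp
  qed simp
  then show "j \<in> {1..Suc m} \<Longrightarrow> count_list (labels c) j = count_list (labels c) (Suc m)" .
  have "set (labels c) \<subseteq> {1..Suc m}"
    using assms(2) by (force simp: labels_def circuit_graph_def)
  then have "length (labels c) = (\<Sum>j\<in>{1..Suc m}. count_list (labels c) j)"
    by (intro sum_count_set[symmetric]) auto
  also have "\<dots> = (\<Sum>j\<in>{1..Suc m}. count_list (labels c) (Suc m))"
    by (rule sum.cong[OF refl eq])
  finally show "length c = Suc m * count_list (labels c) (Suc m)"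
    by (simp add: labels_def)
qed

lemma circuit_length_ge:
  assumes "pre_digraph.cycle (circuit_graph k (Suc m)) c"
  shows "Suc m \<le> length c"
proof -
  obtain e where "pre_digraph.cas (circuit_graph k (Suc m)) e c e"
      "set c \<subseteq> arcs (circuit_graph k (Suc m))" "c \<noteq> []"
    using assms by (auto simp: pre_digraph.cycle_def pre_digraph.awalk_def)
  then have "length c = Suc m * count_list (labels c) (Suc m)" "length c \<noteq> 0"
    using closed_walk_count_labels(2) by blast+
  then show ?thesis by (cases "count_list (labels c) (Suc m)") auto
qed

text \<open>Once the arc labelled \<open>Suc m\<close> is cut out, the other arcs carry each label
  from 1 to \<open>m\<close> once. Along them the counting function drops exactly once at each
  index, by 1, so the vertices interlace.\<close>

lemma circuit_sorted_collection:
  assumes c: "pre_digraph.cycle (circuit_graph k (Suc m)) c" and len: "length c = Suc m"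
  obtains Is where "sorted_collection k (Suc m) Is" "length Is = Suc m"
    "fst ` set c = eps ` set Is"
proof -
  let ?G = "circuit_graph k (Suc m)"
  obtain e where e: "pre_digraph.cas ?G e c e" and arcs: "set c \<subseteq> arcs ?G"
    using c by (auto simp: pre_digraph.cycle_def pre_digraph.awalk_def)
  have top: "count_list (labels c) (Suc m) = 1"
    using closed_walk_count_labels(2)[OF e arcs] unfolding len
    by (metis mult_eq_self_implies_10 nat.distinct(2))
  then have one: "count_list (labels c) j = 1" if "j \<in> {1..Suc m}" for j
    using closed_walk_count_labels(1)[OF e arcs that] by simp
  have "Suc m \<in> set (labels c)"
    using top by (metis count_notin zero_neq_one)
  then obtain a where a: "a \<in> set c" "fst (snd a) = Suc m"
    by (auto simp: labels_def)
  then obtain p q where pq: "c = p @ a # q"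
    by (auto simp: in_set_conv_decomp)
  \<comment> \<open>Rotate the circuit so that the arc with label \<open>n\<close> comes last.\<close>
  define b where "b = q @ p"
  have "pre_digraph.cas ?G e p (fst a)" "pre_digraph.cas ?G (snd (snd a)) q e"
    using e by (auto simp: pq cas_append pre_digraph.cas.simps)
  then have b: "pre_digraph.cas ?G (snd (snd a)) b (fst a)"
    unfolding b_def cas_append by blast
  have lenb: "length b = m"
    using len by (simp add: b_def pq)
  have barcs: "set b \<subseteq> arcs ?G" and aarc: "a \<in> arcs ?G"
    using arcs by (auto simp: b_def pq)
  have cb: "count_list (labels b) j = (if j = Suc m then 0 else 1)" if "j \<in> {1..Suc m}" for j
    using one[OF that] a(2) by (auto simp: labels_def b_def pq)
  have notin: "Suc m \<notin> set (labels b)"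
    using cb[of "Suc m"] by (simp add: count_list_0_iff)
  have dist: "distinct (labels b)"
  proof -
    have "set (labels b) \<subseteq> {1..Suc m}"
      using barcs by (force simp: labels_def circuit_graph_def)
    then have "{1..m} = set (labels b)"
      using notin cb count_notin by (fastforce simp: le_Suc_eq)
    then have "card (set (labels b)) = length (labels b)"
      using lenb by (metis card_atLeastAtMost diff_Suc_1 labels_def length_map)
    then show ?thesis by (rule card_distinct)
  qed
  \<comment> \<open>The vertices in order, from the head of the cut arc \<open>a\<close> (index 0)
    to its tail (index \<open>m\<close>).\<close>
  define v where "v s = (if s < m then fst (b ! s) else fst a)" for s
  have cas: "pre_digraph.cas ?G (v 0) (take s b) (v s)" if "s \<le> m" for s
  proof -
    have "pre_digraph.cas ?G (snd (snd a)) (take s b @ drop s b) (fst a)"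
      using b by simp
    then obtain x where x: "pre_digraph.cas ?G (snd (snd a)) (take s b) x"
        "pre_digraph.cas ?G x (drop s b) (fst a)"
      unfolding cas_append by blast
    have "x = v s"
    proof (cases "s < m")
      case True
      then have "drop s b = b ! s # drop (Suc s) b"
        by (simp add: Cons_nth_drop_Suc lenb)
      then show ?thesis using x(2) True by (simp add: pre_digraph.cas.simps v_def)
    next
      case False
      then show ?thesis using x(2) lenb by (simp add: pre_digraph.cas.simps v_def)
    qed
    moreover have "snd (snd a) = v 0"
    proof (cases "0 < m")
      case True
      then have "b = b ! 0 # drop (Suc 0) b"
        using Cons_nth_drop_Suc[of 0 b] lenb by simp
      then show ?thesis using b True by (metis circuit_graph_simps(1) pre_digraph.cas.simps(2) v_def)
    next
      case False
      then show ?thesis using b lenb by (simp add: pre_digraph.cas.simps v_def)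
    qed
    ultimately show ?thesis using x(1) by simp
  qed
  have "v s \<in> eps ` k_subsets k (Suc m)" if "s \<le> m" for s
  proof -
    have "v s \<in> fst ` arcs ?G"
    proof (cases "s < m")
      case True
      then have "b ! s \<in> arcs ?G" using barcs lenb by (auto intro: nth_mem)
      then show ?thesis using True by (simp add: v_def)
    next
      case False
      then show ?thesis using aarc by (simp add: v_def)
    qed
    then show ?thesis by (auto simp: circuit_graph_def)
  qed
  then have "\<forall>s\<in>{..m}. \<exists>J. J \<in> k_subsets k (Suc m) \<and> v s = eps J"
    by blast
  then obtain I where "\<forall>s\<in>{..m}. I s \<in> k_subsets k (Suc m) \<and> v s = eps (I s)"
    by (rule bchoice[THEN exE])
  then have I: "I s \<in> k_subsets k (Suc m)" "v s = eps (I s)" if "s \<le> m" for s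
    using that by auto
  \<comment> \<open>At vertex \<open>s\<close> the value at \<open>j\<close> has dropped if and only
    if label \<open>j\<close> is among the first \<open>s\<close> labels.\<close>
  have F: "int (card_upto (I s) j) = int (card_upto (I 0) j) - of_bool (j \<in> set (take s (labels b)))"
    if s: "s \<le> m" and j: "j \<in> {1..m}" for s j
  proof -
    have lt: "labels (take s b) = take s (labels b)"
      by (simp add: labels_def take_map)
    have "set (take s b) \<subseteq> arcs ?G"
      using barcs set_take_subset[of s b] by blast
    from circuit_walk_z_coord[OF cas[OF s] this j]
    have "z_coord (v s) j = z_coord (v 0) j - real (count_list (take s (labels b)) j) +
        real (count_list (take s (labels b)) (Suc m))"
      by (simp add: lt)
    moreover have "count_list (take s (labels b)) (Suc m) = 0"
      using notin by (meson count_notin in_set_takeD)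
    moreover have "count_list (take s (labels b)) j = of_bool (j \<in> set (take s (labels b)))"
      using dist by (auto simp: distinct_take count_list_eq_length_filter distinct_length_filter)
    ultimately have "real (card_upto (I s) j) =
        real (card_upto (I 0) j) - of_bool (j \<in> set (take s (labels b)))"
      using I[OF s] I[of 0] by (simp add: z_coord_eps[OF I(1)[OF s]] z_coord_eps[OF I(1)[of 0]])
    then have "real_of_int (int (card_upto (I s) j)) =
        real_of_int (int (card_upto (I 0) j) - of_bool (j \<in> set (take s (labels b))))"
      by simp
    then show ?thesis by (simp only: of_int_eq_iff)
  qed
  have pair: "card_upto (I t) j \<le> card_upto (I s) j \<and> card_upto (I s) j \<le> card_upto (I t) j + 1"
    if st: "s < t" "t \<le> m" for s t j
  proof (cases "j \<in> {1..m}")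
    case True
    have "set (take s (labels b)) \<subseteq> set (take t (labels b))"
      using st by (simp add: set_take_subset_set_take)
    then show ?thesis
      using F[OF _ True, of s] F[OF _ True, of t] st
      by (cases "j \<in> set (take s (labels b))"; cases "j \<in> set (take t (labels b))") auto
  next
    case False
    have "s \<le> m" using st by simp
    note mem = I(1)[OF this] I(1)[OF st(2)]
    show ?thesis
    proof (cases "j = 0")
      case True
      then show ?thesis by (simp add: card_upto_0[OF mem(1)] card_upto_0[OF mem(2)])
    next
      case False
      then have "Suc m \<le> j" using \<open>j \<notin> {1..m}\<close> by auto
      then show ?thesis by (simp add: card_upto_top[OF mem(1)] card_upto_top[OF mem(2)])
    qed
  qed
  have inj: "inj_on I {..m}"
  proof (rule linorder_inj_onI)
    fix s t assume st: "s < t" "s \<in> {..m}" "t \<in> {..m}"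
    \<comment> \<open>The arc leaving vertex \<open>s\<close> is traversed before vertex
      \<open>t\<close> is reached, so its label separates the two sets.\<close>
    define j where "j = labels b ! s"
    have ll: "length (labels b) = m" by (simp add: labels_def lenb)
    then have jin: "j \<in> set (labels b)" using st by (simp add: j_def)
    moreover have "set (labels b) \<subseteq> {1..Suc m}"
      using barcs by (force simp: labels_def circuit_graph_def)
    ultimately have j: "j \<in> {1..m}" using notin by (force simp: le_Suc_eq)
    have "j \<in> set (take t (labels b))"
      using st ll by (auto simp: j_def in_set_conv_nth intro!: exI[of _ s])
    moreover have "j \<notin> set (take s (labels b))"
      using st ll dist by (auto simp: j_def in_set_conv_nth nth_eq_iff_index_eq)
    ultimately have "card_upto (I s) j \<noteq> card_upto (I t) j"
      using F[OF _ j, of s] F[OF _ j, of t] st by auto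
    then show "I s \<noteq> I t" by auto
  qed auto
  show ?thesis
  proof (rule that[of "map I [0..<Suc m]"])
    show "sorted_collection k (Suc m) (map I [0..<Suc m])"
      unfolding sorted_collection_def
    proof (intro conjI allI impI)
      show "set (map I [0..<Suc m]) \<subseteq> k_subsets k (Suc m)"
        unfolding set_map_upto using I(1) by auto
      show "distinct (map I [0..<Suc m])"
        using inj by (simp add: distinct_map atLeast0LessThan lessThan_Suc_atMost del: upt_Suc)
      fix s t assume st: "s < t \<and> t < length (map I [0..<Suc m])"
      then have "s \<le> m" "t \<le> m" by simp_all
      then have "sorted_pair (I s) (I t)"
        using sorted_pair_iff[OF I(1) I(1), of s t] pair[of s t] st by blast
      then show "sorted_pair (map I [0..<Suc m] ! s) (map I [0..<Suc m] ! t)"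
        using st by (simp del: upt_Suc)
    qed
    have "fst ` set c = v ` {..m}"
    proof -
      have "fst ` set c = insert (fst a) (fst ` set b)"
        by (auto simp: pq b_def)
      also have "fst ` set b = v ` {..<m}"
        using lenb by (force simp: v_def in_set_conv_nth image_iff)
      also have "insert (fst a) (v ` {..<m}) = v ` {..m}"
      proof -
        have "v m = fst a" by (simp add: v_def)
        then show ?thesis by (simp add: lessThan_Suc flip: lessThan_Suc_atMost)
      qed
      finally show ?thesis .
    qed
    also have "\<dots> = eps ` set (map I [0..<Suc m])"
      unfolding set_map_upto image_image using I(2) by auto
    finally show "fst ` set c = eps ` set (map I [0..<Suc m])" .
  qed simp
qed

section \<open>The circuit through the vertices of a cell\<close>

lemma cell_set_step:
  assumes u: "u permutes {1..m}" and s: "s < m"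
  defines "i \<equiv> inv u (Suc s)"
  shows "i \<in> cell_set (Suc m) u s" "Suc i \<notin> cell_set (Suc m) u s"
    "cell_set (Suc m) u (Suc s) = insert (Suc i) (cell_set (Suc m) u s - {i})"
    "1 \<le> i" "i \<le> m"
proof -
  have ui: "u i = Suc s" by (simp add: i_def permutes_inverses[OF u])
  show i1: "1 \<le> i"
    using ui permutes_zero[OF u] by (cases i) auto
  show im: "i \<le> m"
    using permutes_inv_le[OF u, of "Suc s"] s by (simp add: i_def)
  \<comment> \<open>From vertex \<open>s\<close> to vertex \<open>Suc s\<close> the counting
    function changes only at the index \<open>i\<close> of rank \<open>Suc s\<close>, where it drops
    by 1. As both functions have steps 0 or 1, this forces the element \<open>i\<close> to move to
    \<open>Suc i\<close>.\<close>
  have Z: "zvert u s j = zvert u (Suc s) j + (if j = i then 1 else 0)" for j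
    using ui permutes_eq_iff[OF u, of j i] by (auto simp: zvert_def)
  obtain i' where i': "i = Suc i'" using i1 by (cases i) auto
  have at_i: "zvert u s i \<noteq> zvert u s (i - 1)" "zvert u (Suc s) i = zvert u (Suc s) (i - 1)"
    using Z[of i] Z[of i'] zvert_Suc[of u s i'] zvert_Suc[of u "Suc s" i'] by (auto simp: i')
  have at_Si: "zvert u s (Suc i) = zvert u s i" "zvert u (Suc s) (Suc i) \<noteq> zvert u (Suc s) i"
    using Z[of i] Z[of "Suc i"] zvert_Suc[of u s i] zvert_Suc[of u "Suc s" i] by auto
  have other: "zvert u (Suc s) j = zvert u (Suc s) (j - 1) \<longleftrightarrow> zvert u s j = zvert u s (j - 1)"
    if "j \<noteq> i" "j \<noteq> Suc i" "1 \<le> j" for j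
    using Z[of j] Z[of "j - 1"] that by auto
  show "i \<in> cell_set (Suc m) u s" "Suc i \<notin> cell_set (Suc m) u s"
    using at_i at_Si i1 im by (auto simp: cell_set_def)
  show "cell_set (Suc m) u (Suc s) = insert (Suc i) (cell_set (Suc m) u s - {i})"
  proof (rule set_eqI)
    fix j
    consider "j = i" | "j = Suc i" | "j \<noteq> i" "j \<noteq> Suc i" "1 \<le> j" | "j = 0" by linarith
    then show "j \<in> cell_set (Suc m) u (Suc s) \<longleftrightarrow> j \<in> insert (Suc i) (cell_set (Suc m) u s - {i})"
    proof cases
      case 3
      then show ?thesis using other[OF 3] by (auto simp: cell_set_def)
    qed (use at_i at_Si i1 im in \<open>auto simp: cell_set_def\<close>)
  qed
qed

text \<open>The closing arc, with label \<open>Suc m\<close>: the counting function of vertex 0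
  exceeds that of vertex \<open>m\<close> by 1 at all indices from 1 to \<open>m\<close>, while they
  agree at 0 and at \<open>Suc m\<close>.\<close>

lemma cell_set_last_step:
  assumes u: "u permutes {1..m}" and m: "1 \<le> m"
  shows "Suc m \<in> cell_set (Suc m) u m" "1 \<notin> cell_set (Suc m) u m"
    "cell_set (Suc m) u 0 = insert 1 (cell_set (Suc m) u m - {Suc m})"
proof -
  have top: "zvert u s (Suc m) = Suc (des u m)" if "s \<le> m" for s
    using zvert_top[OF u that] .
  have zm: "zvert u m j = des u j" if "j \<le> m" for j
    using permutes_le_iff[OF u, of j] that by (simp add: zvert_def)
  have z0: "zvert u 0 j = des u j + (if j = 0 then 0 else 1)" for j
    using permutes_zero_less[OF u, of j] permutes_zero[OF u] by (auto simp: zvert_def)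
  have d1: "des u 1 = 0"
    using des_Suc[of u 0] permutes_zero[OF u] by simp
  show "Suc m \<in> cell_set (Suc m) u m" "1 \<notin> cell_set (Suc m) u m"
    using top[of m] zm[of m] zm[of 1] zm[of 0] d1 m by (auto simp: cell_set_def)
  show "cell_set (Suc m) u 0 = insert 1 (cell_set (Suc m) u m - {Suc m})"
  proof (rule set_eqI)
    fix j
    consider "j = 1" | "j = Suc m" | "2 \<le> j" "j \<le> m" | "j = 0" | "Suc m < j" by linarith
    then show "j \<in> cell_set (Suc m) u 0 \<longleftrightarrow> j \<in> insert 1 (cell_set (Suc m) u m - {Suc m})"
    proof cases
      case 1
      then show ?thesis using z0[of 1] z0[of 0] d1 m by (auto simp: cell_set_def)
    next
      case 2
      then show ?thesis using top[of 0] z0[of m] m by (auto simp: cell_set_def)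
    next
      case 3
      then show ?thesis
        using z0[of j] z0[of "j - 1"] zm[of j] zm[of "j - 1"] by (auto simp: cell_set_def)
    qed (auto simp: cell_set_def)
  qed
qed

lemma cas_map_upt:
  "i \<le> j \<Longrightarrow> pre_digraph.cas (circuit_graph k n) (f i) (map (\<lambda>s. (f s, l s, f (Suc s))) [i..<j]) (f j)"
proof (induction rule: inc_induct)
  case (step i)
  then show ?case by (simp add: upt_conv_Cons pre_digraph.cas.simps)
qed (simp add: pre_digraph.cas.simps)

lemma cell_circuit:
  assumes u: "u \<in> cell_perms k m" and m: "1 \<le> m"
  obtains c where "pre_digraph.cycle (circuit_graph k (Suc m)) c" "length c = Suc m"
    "fst ` set c = eps ` cell_set (Suc m) u ` {..m}"
proof -
  let ?G = "circuit_graph k (Suc m)"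
  note p = cell_permsD[OF u]
  \<comment> \<open>The reduction modulo \<open>Suc m\<close> lets the arc after vertex
    \<open>m\<close> end at vertex 0. Its label is \<open>inv u (Suc m) = Suc m\<close>, so one
    formula gives all labels.\<close>
  define f where "f s = eps (cell_set (Suc m) u (s mod Suc m))" for s
  define c where "c = map (\<lambda>s. (f s, inv u (Suc s), f (Suc s))) [0..<Suc m]"
  have mem: "cell_set (Suc m) u s \<in> k_subsets k (Suc m)" if "s \<le> m" for s
    using cell_set_mem[OF p(1) that] p(2) by simp
  have "(f s, inv u (Suc s), f (Suc s)) \<in> arcs ?G" if "s \<le> m" for s
  proof (cases "s < m")
    case True
    then have "f s = eps (cell_set (Suc m) u s)" "f (Suc s) = eps (cell_set (Suc m) u (Suc s))"
      by (simp_all add: f_def)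
    moreover have "cyc_succ (Suc m) (inv u (Suc s)) = Suc (inv u (Suc s))"
      using cell_set_step(5)[OF p(1) True] by (simp add: cyc_succ_def)
    ultimately show ?thesis
      using circuit_arcI[OF mem[OF that]] cell_set_step[OF p(1) True] by metis
  next
    case False
    then have s: "s = m" using that by simp
    have "f s = eps (cell_set (Suc m) u m)" "f (Suc s) = eps (cell_set (Suc m) u 0)"
      by (simp_all add: f_def s)
    moreover have "inv u (Suc s) = Suc m"
      using permutes_Suc_top[OF permutes_inv[OF p(1)]] s by simp
    moreover have "cyc_succ (Suc m) (Suc m) = 1"
      by (simp add: cyc_succ_def)
    ultimately show ?thesis
      using circuit_arcI[OF mem[of m]] cell_set_last_step[OF p(1) m] by (metis order_refl)
  qed
  then have "set c \<subseteq> arcs ?G"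
    by (auto simp: c_def simp del: upt_Suc)
  moreover have "pre_digraph.cas ?G (f 0) c (f (Suc m))"
    unfolding c_def by (rule cas_map_upt) simp
  moreover have "f (Suc m) = f 0" by (simp add: f_def)
  moreover have "f 0 \<in> verts ?G"
    using mem[of 0] by (simp add: f_def)
  ultimately have walk: "pre_digraph.awalk ?G (f 0) c (f 0)"
    by (simp add: pre_digraph.awalk_def)
  have ne: "c \<noteq> []" by (simp add: c_def)
  \<comment> \<open>A cycle must visit distinct vertices after its starting point, that is, its arcs
    must have distinct heads.\<close>
  have "tl (pre_digraph.awalk_verts ?G (f 0) c) = map (\<lambda>a. snd (snd a)) c"
    using pre_digraph.awalk_verts_conv'[of ?G "f 0" c "f 0"] walk ne
    by (auto simp: pre_digraph.awalk_def)
  also have "\<dots> = map (f \<circ> Suc) [0..<Suc m]"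
    by (simp add: c_def del: upt_Suc)
  also have "distinct \<dots>"
  proof -
    have "inj_on (f \<circ> Suc) {..m}"
    proof (rule inj_onI)
      fix s t assume st: "s \<in> {..m}" "t \<in> {..m}" "(f \<circ> Suc) s = (f \<circ> Suc) t"
      then have "cell_set (Suc m) u (Suc s mod Suc m) = cell_set (Suc m) u (Suc t mod Suc m)"
        using inj_eps by (simp add: f_def inj_eq)
      moreover have "Suc s mod Suc m \<le> m" "Suc t mod Suc m \<le> m"
        using mod_less_divisor[of "Suc m"] by (simp_all add: less_Suc_eq_le del: mod_less_divisor)
      ultimately have "Suc s mod Suc m = Suc t mod Suc m"
        using inj_on_cell_set[OF p(1)] by (auto dest: inj_onD)
      moreover have "Suc r mod Suc m = (if r = m then 0 else Suc r)" if "r \<le> m" for r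
        using that by simp
      ultimately show "s = t" using st(1,2) by (auto split: if_splits)
    qed
    then show ?thesis
      by (simp add: distinct_map atLeast0LessThan lessThan_Suc_atMost del: upt_Suc)
  qed
  finally have "pre_digraph.cycle ?G c"
    unfolding pre_digraph.cycle_def using walk ne by blast
  moreover have "fst ` set c = eps ` cell_set (Suc m) u ` {..m}"
    unfolding c_def set_map_upto image_image by (auto simp: f_def)
  ultimately show ?thesis using that by (simp add: c_def)
qed

text \<open>Some cell exists and provides a circuit of length \<open>Suc m\<close>, so the minimal
  length is exactly that. The vertices of such a circuit form a sorted collection of maximal size,
  which reduces the claim to Sturmfels' simplices.\<close>

lemma circuit_simplices_eq:
  assumes km: "1 \<le> m" "0 < k" "k \<le> m"
  shows "circuit_simplices k (Suc m) = closed_cell m ` cell_perms k m"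
proof (intro equalityI subsetI)
  obtain q where "q \<in> proj_hypersimplex k (Suc m)"
    using exists_generic_point[OF km] .
  then obtain u0 where u0: "u0 \<in> cell_perms k m"
    using closed_cells_cover km by blast
  fix A assume "A \<in> circuit_simplices k (Suc m)"
  then obtain c where c: "minimal_circuit k (Suc m) c"
      "A = drop_last_coord (Suc m) ` (convex hull (fst ` set c))"
    by (auto simp: circuit_simplices_def)
  have cyc: "pre_digraph.cycle (circuit_graph k (Suc m)) c"
    using c(1) by (simp add: minimal_circuit_def is_arg_min_def)
  moreover have "length c = Suc m"
  proof -
    obtain c0 where "pre_digraph.cycle (circuit_graph k (Suc m)) c0" "length c0 = Suc m"
        "fst ` set c0 = eps ` cell_set (Suc m) u0 ` {..m}"
      by (rule cell_circuit[OF u0 km(1)])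
    then have "\<not> Suc m < length c"
      using c(1) by (auto simp: is_arg_min_def minimal_circuit_def)
    then show ?thesis using circuit_length_ge[OF cyc] by simp
  qed
  ultimately obtain Is where "sorted_collection k (Suc m) Is" "length Is = Suc m"
      "fst ` set c = eps ` set Is"
    using circuit_sorted_collection by metis
  then have "maximal_sorted_collection k (Suc m) Is"
      "A = drop_last_coord (Suc m) ` (convex hull (eps ` set Is))"
    using sorted_collection_maximalI c(2) by simp_all
  then have "A \<in> sturmfels_simplices k (Suc m)"
    unfolding sturmfels_simplices_def by blast
  then show "A \<in> closed_cell m ` cell_perms k m"
    using sturmfels_simplices_eq[OF km] by simp
next
  fix A assume "A \<in> closed_cell m ` cell_perms k m"
  then obtain u where u: "u \<in> cell_perms k m" "A = closed_cell m u" by blast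
  obtain c where c: "pre_digraph.cycle (circuit_graph k (Suc m)) c" "length c = Suc m"
      "fst ` set c = eps ` cell_set (Suc m) u ` {..m}"
    by (rule cell_circuit[OF u(1) km(1)])
  have "minimal_circuit k (Suc m) c"
    unfolding minimal_circuit_def is_arg_min_def
    using c(1,2) by (auto dest: circuit_length_ge)
  moreover have "A = drop_last_coord (Suc m) ` (convex hull (tail (circuit_graph k (Suc m)) ` set c))"
    using u(2) closed_cell_eq_image_hull[OF cell_permsD(1)[OF u(1)]] c(3) by simp
  ultimately show "A \<in> circuit_simplices k (Suc m)"
    unfolding circuit_simplices_def by blast
qed

theorem theorem2p7:
  fixes k n :: nat
  assumes "0 < k" and "k < n"
  shows "linear (drop_last_coord n)
    \<and> bij_betw (drop_last_coord n) (hypersimplex k n) (proj_hypersimplex k n)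
    \<and> (\<forall>S \<in> stanley_simplices k n. is_simplex (n - 1) S \<and> S \<subseteq> proj_hypersimplex k n)
    \<and> stanley_simplices k n = sturmfels_simplices k n
    \<and> sturmfels_simplices k n = alcove_simplices k n
    \<and> alcove_simplices k n = circuit_simplices k n"
proof -
  obtain m where n: "n = Suc m" and km: "1 \<le> m" "0 < k" "k \<le> m"
    using assms by (cases n) auto
  have "is_simplex m S \<and> S \<subseteq> proj_hypersimplex k (Suc m)" if "S \<in> closed_cell m ` cell_perms k m" for S
    using that is_simplex_closed_cell closed_cell_subset_proj_hypersimplex
    by (force simp: cell_perms_def)
  then show ?thesis
    unfolding n stanley_simplices_eq[OF km(1,2)] sturmfels_simplices_eq[OF km]
      alcove_simplices_eq[OF km(1,2)] circuit_simplices_eq[OF km]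
    using linear_drop_last_coord bij_betw_drop_last_coord[OF km] by simp
qed

end
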